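(* Let $K$ be a field, let $(D,r)$ be a non-degenerate braided set, where $D$ is the incidence coalgebra over $K$ of a locally finite poset $(X,\le)$, and let $x,y\in X$ with $x\prec y$ and $r_{|}(x,x)=(x,x)$, $r_{|}(x,y)=(y,x)$, $r_{|}(y,x)=(x,y)$, $r_{|}(y,y)=(y,y)$. Let $M$ be the $9\times 9$ matrix and $\alpha_i,\beta_i,A,B_i,\Gamma_i$ $(1\le i\le4)$ the scalars defined in the context, and if some $\beta_i\neq0$ let $C$ be as in the context. The following facts hold, where in each case "$M$ belongs to the family $T$ with ..." means that $M$ is equal to the matrix $$T=\begin{pmatrix}1&\beta_1&0&\beta_2&\Gamma_1&0&0&0&0\\0&0&0&\alpha_2&B_1&0&0&0&0\\0&0&0&-\beta_2&\Gamma_2&0&1&\beta_4&0\\0&\alpha_1&0&0&B_2&0&0&0&0\\0&0&0&0&A&0&0&0&0\\0&0&0&0&B_3&0&0&\alpha_4&0\\0&-\beta_1&1&0&\Gamma_3&\beta_3&0&0&0\\0&0&0&0&B_4&\alpha_3&0&0&0\\0&0&0&0&\Gamma_4&-\beta_3&0&-\beta_4&1\end{pmatrix}$$ with entries satisfying the listed relations, for some values of the listed parameters. 1) If $\beta_i=0$ for $i=1,2,3,4$ and $\Gamma_1=0$, then $M$ belongs to the family $T$ with $\alpha_4=\alpha_1\alpha_3/\alpha_2$, $A=\alpha_1\alpha_3$, and all $\beta_i,B_i,\Gamma_i$ equal to $0$, parameterized by $\alpha_1,\alpha_2,\alpha_3\in K^\times$. 2) If $\beta_i=0$ for $i=1,2,3,4$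 and $\Gamma_1\ne0$, then $M$ belongs to the family $T$ with $\alpha_2=\alpha_1$, $\alpha_4=\alpha_3$, $A=\alpha_1\alpha_3$, all $\beta_i$ and $B_i$ equal to $0$, $\Gamma_2=\Gamma_3=0$, $\Gamma_4=-\Gamma_1$, parameterized by $\alpha_1=\pm1$, $\alpha_3=\pm1$ (independent signs) and $\Gamma_1\in K^\times$. 3) If some $\beta_i\neq0$ and $C=0$, then either ($\beta_3=\beta_2$ and $\beta_4=\beta_1$), or ($\beta_3+\beta_4=\beta_1+\beta_2=0$ and $\beta_3\ne-\beta_1$). In the first case $M$ belongs to the family $T$ with all $\alpha_i=1$, $A=1$, $\beta_3=\beta_2$, $\beta_4=\beta_1$, $B_1=\beta_1$, $B_2=\beta_2$, $B_3=-\beta_2$, $B_4=-\beta_1$, $\Gamma_2=\Gamma_3=-\beta_1\beta_2$, $\Gamma_4=2\beta_1\beta_2-\Gamma_1$, parameterized by $\Gamma_1,\beta_1,\beta_2\in K$ with $(\beta_1,\beta_2)\neq(0,0)$. In the second case $M$ belongs to the family $T$ with all $\alpha_i=1$, $A=1$, $\beta_2=-\beta_1$, $\beta_4=-\beta_3$, $B_1=-\beta_3$, $B_2=\beta_3$, $B_3=\beta_1$, $B_4=-\beta_1$, $\Gamma_1=\Gamma_4=\beta_1\beta_3$, $\Gamma_2=\Gamma_3=-\beta_1\beta_3$, parameterized by $\beta_1,\beta_3\in K$ with $\beta_1+\beta_3\ne0$. 4) If some $\beta_i\neq0$ and $C\ne0$, then $$\beta_1(\alpha_1+1)(\beta_3\alpha_1-\beta_2-\Gamma_1C)=0.$$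 4a) If $C\neq0$, some $\beta_i\ne0$ and $\beta_1=0$, then either $\Gamma_1=\alpha_2\beta_4/C$, or ($\beta_2=0$ and $\Gamma_1\neq\beta_4/C$). In the first case $M$ belongs to the family $T$ with $\beta_1=0$, $\alpha_i=1+C\beta_i$ for all $i$ (so $\alpha_1=1$), $\beta_3=\beta_2+\alpha_2\beta_4$, $A=\alpha_2\alpha_4$, $B_1=\alpha_2\beta_4$, $B_2=\beta_3$, $B_3=-\alpha_4\beta_2$, $B_4=0$, $\Gamma_1=\alpha_2\beta_4/C$, $\Gamma_2=-\beta_2\beta_4$, $\Gamma_3=0$, $\Gamma_4=\beta_2\beta_4-\alpha_2\beta_4/C$, parameterized by $C\in K^\times$ and $\beta_2,\beta_4\in K$ with $(\beta_2,\beta_4)\ne(0,0)$ such that $C\beta_i\neq-1$ for all $i$. In the second case $M$ belongs to the family $T$ with $\alpha_1=\alpha_2=1$, $\alpha_3=\alpha_4=-1$, $\beta_1=\beta_2=0$, $\beta_3=\beta_4$, $A=-1$, $B_1=B_2=\beta_4$, $B_3=B_4=0$, $\Gamma_2=\Gamma_3=0$, $\Gamma_4=-\Gamma_1$, parameterized by $\Gamma_1\in K\setminus\{-\beta_4^2/2\}$ and $\beta_4\in K^\times$. 4b) If $C\neq0$, $\beta_1\neq0$ and $\alpha_1+1=0$, then either $\alpha_2=-1$, or ($\alpha_2\beta_4C-C^2\Gamma_1=-2$ and $\alpha_2\neq-1$). In the first case $M$ belongs to the family $T$ with $\beta_2=\beta_1$, $\alpha_i=1+C\beta_i=1-\frac{2\beta_i}{\beta_1}$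 for all $i$ (so $\alpha_1=\alpha_2=-1$), $A=-\alpha_4$, $B_1=-\beta_4$, $B_2=-\beta_3$, $B_3=-\alpha_4\beta_1$, $B_4=-\alpha_3\beta_1$, $\Gamma_2=-\beta_1\beta_4$, $\Gamma_3=-\beta_1\beta_3$, $\Gamma_4=\beta_1(\beta_3+\beta_4)-\Gamma_1$, parameterized by $\beta_1\in K^\times$, $\Gamma_1\in K$ and $\beta_3,\beta_4\in K\setminus\{\beta_1/2\}$. In the second case $M$ belongs to the family $T$ with $\alpha_i=1-\frac{2\beta_i}{\beta_1}$ for all $i$ (so $\alpha_1=-1$), $\beta_3=\frac{2\beta_2\beta_4}{\beta_1}+\beta_1-\beta_2-\beta_4$, $A=\alpha_2\alpha_4$, $B_1=\alpha_2\beta_4$, $B_2=-\beta_3$, $B_3=-\alpha_4\beta_2$, $B_4=2\beta_3-\beta_1$, $\Gamma_1=\frac12(\beta_1^2-\beta_4\beta_1+2\beta_2\beta_4)$, $\Gamma_2=-\beta_2\beta_4$, $\Gamma_3=-\beta_1\beta_3$, $\Gamma_4=\frac12\beta_1(-\beta_1+2\beta_3+\beta_4)$, parameterized by $\beta_1\in K^\times$, $\beta_2\in K\setminus\{\beta_1\}$ and $\beta_4\in K$ such that $\beta_i\neq\beta_1/2$ for all $i$. 4c) If $C\ne0$, $\beta_1\ne0$ and $\alpha_1+1\neq0$, then $M$ belongs to the family $T$ with $\alpha_i=\beta_iC+1$ for all $i$, $\beta_4=(\beta_1-\beta_2+\beta_3+\beta_1\beta_3C)/(1+\beta_2C)$,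 $A=\alpha_2\alpha_4$, $B_1=\alpha_2\beta_4$, $B_2=\alpha_1\beta_3$, $B_3=-\alpha_4\beta_2$, $B_4=-\alpha_3\beta_1$, $\Gamma_1=\frac{\beta_3\alpha_1-\beta_2}{C}$, $\Gamma_2=-\beta_2\beta_4$, $\Gamma_3=-\beta_1\beta_3$, $\Gamma_4=\frac{\beta_4C\beta_2+\beta_2-\beta_3}{C}$, parameterized by $C\in K^\times$, $\beta_1\in K^\times\setminus\{-1/C\}$ and $\beta_2,\beta_3\in K\setminus\{-1/C\}$.
   Context: $K$ is a field and $\otimes=\otimes_K$. $(X,\le)$ is a locally finite poset (every interval $[a,b]=\{c:a\le c\le b\}$ is finite); $x\prec y$ means $x<y$ and $[x,y]=\{x,y\}$. $Y=\{(a,b):a\le b\}$ and $D=KY$ is the incidence coalgebra, $\Delta(a,b)=\sum_{c\in[a,b]}(a,c)\otimes(c,b)$, $\epsilon(a,b)=\delta_{ab}$. $(D,r)$ is a non-degenerate braided set if $r$ is a coalgebra automorphism of $D\otimes D$ with $r_{12}r_{23}r_{12}=r_{23}r_{12}r_{23}$ on $D^{\otimes3}$ ($r_{12}=r\otimes D$, $r_{23}=D\otimes r$) and, with $\sigma=(D\otimes\epsilon)\circ r$, $\tau=(\epsilon\otimes D)\circ r$, there are linear maps $\bar\sigma,\bar\tau\colon D\otimes D\to D$ with $\bar\sigma\circ(D\otimes\sigma)\circ(\Delta\otimes D)=\sigma\circ(D\otimes\bar\sigma)\circ(\Delta\otimes D)=\epsilon\otimes D$ and $\bar\tau\circ(\tau\otimes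 D)\circ(D\otimes\Delta)=\tau\circ(\bar\tau\otimes D)\circ(D\otimes\Delta)=D\otimes\epsilon$. Such an $r$ induces a bijection $r_{|}$ of $X\times X$ via $r((a,a)\otimes(c,c))=(e,e)\otimes(g,g)$ iff $r_{|}(a,c)=(e,g)$. The scalars $\lambda$ are defined by $r((a,b)\otimes(c,d))=\sum_{e\le f,\ g\le h}\lambda_{a|b|c|d}^{e|f|g|h}(e,f)\otimes(g,h)$. Put $f(x,x)=0$, $f(x,y)=1$, $f(y,y)=2$. The $9\times9$ matrix $M$ is defined, for $a_i,b_i\in\{x,y\}$ with $a_i\le b_i$, by $M_{i,j}=\lambda_{a_1|b_1|a_2|b_2}^{a_3|b_3|a_4|b_4}$ if $j=3f(a_1,b_1)+f(a_2,b_2)+1$ and $i=3f(a_3,b_3)+f(a_4,b_4)+1$ (columns are indexed by the inputs of $r$). Moreover $\alpha_1=\lambda_{x|x|x|y}^{x|y|x|x}$, $\alpha_2=\lambda_{x|y|x|x}^{x|x|x|y}$, $\alpha_3=\lambda_{x|y|y|y}^{y|y|x|y}$, $\alpha_4=\lambda_{y|y|x|y}^{x|y|y|y}$; $\beta_1=\lambda_{x|x|x|y}^{x|x|x|x}$, $\beta_2=\lambda_{x|y|x|x}^{x|x|x|x}$, $\beta_3=\lambda_{x|y|y|y}^{y|y|x|x}$, $\beta_4=\lambda_{y|y|x|y}^{x|x|y|y}$; $A=\lambda_{x|y|x|y}^{x|y|x|y}$; $B_1=\lambda_{x|y|x|y}^{x|x|x|y}$, $B_2=\lambda_{x|y|x|y}^{x|y|x|x}$,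 $B_3=\lambda_{x|y|x|y}^{x|y|y|y}$, $B_4=\lambda_{x|y|x|y}^{y|y|x|y}$; $\Gamma_1=\lambda_{x|y|x|y}^{x|x|x|x}$, $\Gamma_2=\lambda_{x|y|x|y}^{x|x|y|y}$, $\Gamma_3=\lambda_{x|y|x|y}^{y|y|x|x}$, $\Gamma_4=\lambda_{x|y|x|y}^{y|y|y|y}$. All $\alpha_i$ are nonzero. If some $\beta_i\neq0$, there is an element $C\in K$ such that $\alpha_i-1=C\beta_i$ for $i=1,2,3,4$; this is the $C$ of items 3) and 4).
   Formalization: In the second case of item 3), the relation Γ₁=Γ₄=β₁β₃ is claimed only when char K≠2; in characteristic 2, where it fails (e.g. K=F₂, β=(0,0,1,1), Γ₁=1), only Γ₁=Γ₄ is claimed. *)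

theory Defs
  imports "HOL-Library.Poly_Mapping" "Jordan_Normal_Form.Matrix"
begin

text \<open>
  Vector spaces with a distinguished basis \<open>B\<close> are rendered as the finitely supported functions
  \<open>B \<Rightarrow>\<^sub>0 K\<close>. The tensor product of \<open>B \<Rightarrow>\<^sub>0 K\<close> and \<open>C \<Rightarrow>\<^sub>0 K\<close> is \<open>B \<times> C \<Rightarrow>\<^sub>0 K\<close>, where
  the basis vector \<open>(b, c)\<close> stands for the pure tensor of \<open>b\<close> and \<open>c\<close>; tensoring with \<open>K\<close> itself
  is suppressed. Since products of types are not associative, the two bracketings of a triple
  tensor product are linked by \<open>assoc\<close> and \<open>assoc_inv\<close>.
\<close>

definition scale :: "'k::field \<Rightarrow> ('b \<Rightarrow>\<^sub>0 'k) \<Rightarrow> ('b \<Rightarrow>\<^sub>0 'k)" where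
  "scale c v = Poly_Mapping.map ((*) c) v"

abbreviation is_linear :: "(('b \<Rightarrow>\<^sub>0 'k::field) \<Rightarrow> ('c \<Rightarrow>\<^sub>0 'k)) \<Rightarrow> bool" where
  "is_linear \<equiv> Vector_Spaces.linear scale scale"

definition basis :: "'b \<Rightarrow> ('b \<Rightarrow>\<^sub>0 'k::field)" where
  "basis b = Poly_Mapping.single b 1"

definition extend :: "('b \<Rightarrow> ('c \<Rightarrow>\<^sub>0 'k)) \<Rightarrow> ('b \<Rightarrow>\<^sub>0 'k::field) \<Rightarrow> ('c \<Rightarrow>\<^sub>0 'k)" where
  "extend f v = (\<Sum>b\<in>Poly_Mapping.keys v. scale (Poly_Mapping.lookup v b) (f b))"

definition extend_scalar :: "('b \<Rightarrow> 'k) \<Rightarrow> ('b \<Rightarrow>\<^sub>0 'k::field) \<Rightarrow> 'k" where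
  "extend_scalar f v = (\<Sum>b\<in>Poly_Mapping.keys v. Poly_Mapping.lookup v b * f b)"

definition tensor_vec :: "('b \<Rightarrow>\<^sub>0 'k::field) \<Rightarrow> ('c \<Rightarrow>\<^sub>0 'k) \<Rightarrow> ('b \<times> 'c \<Rightarrow>\<^sub>0 'k)" where
  "tensor_vec u v = extend (\<lambda>b. extend (\<lambda>c. basis (b, c)) v) u"

definition tensor_map ::
  "(('b \<Rightarrow>\<^sub>0 'k::field) \<Rightarrow> ('c \<Rightarrow>\<^sub>0 'k)) \<Rightarrow> (('d \<Rightarrow>\<^sub>0 'k) \<Rightarrow> ('e \<Rightarrow>\<^sub>0 'k))
    \<Rightarrow> ('b \<times> 'd \<Rightarrow>\<^sub>0 'k) \<Rightarrow> ('c \<times> 'e \<Rightarrow>\<^sub>0 'k)" where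
  "tensor_map f g = extend (\<lambda>(b, d). tensor_vec (f (basis b)) (g (basis d)))"

definition assoc :: "(('b \<times> 'c) \<times> 'd \<Rightarrow>\<^sub>0 'k::field) \<Rightarrow> ('b \<times> 'c \<times> 'd \<Rightarrow>\<^sub>0 'k)" where
  "assoc = extend (\<lambda>((b, c), d). basis (b, c, d))"

definition assoc_inv :: "('b \<times> 'c \<times> 'd \<Rightarrow>\<^sub>0 'k::field) \<Rightarrow> (('b \<times> 'c) \<times> 'd \<Rightarrow>\<^sub>0 'k)" where
  "assoc_inv = extend (\<lambda>(b, c, d). basis ((b, c), d))"

definition middle_swap ::
  "(('b \<times> 'c) \<times> ('d \<times> 'e) \<Rightarrow>\<^sub>0 'k::field) \<Rightarrow> (('b \<times> 'd) \<times> ('c \<times> 'e) \<Rightarrow>\<^sub>0 'k)" where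
  "middle_swap = extend (\<lambda>((b, c), (d, e)). basis ((b, d), (c, e)))"

typedef (overloaded) 'a ival = "{(a, b). a \<le> (b :: 'a::order)}"
  by auto

text \<open>The term \<open>ival a b\<close> is meaningful only for \<open>a \<le> b\<close>.\<close>

definition ival :: "'a::order \<Rightarrow> 'a \<Rightarrow> 'a ival" where
  "ival a b = Abs_ival (a, b)"

definition lower :: "'a::order ival \<Rightarrow> 'a" where
  "lower p = fst (Rep_ival p)"

definition upper :: "'a::order ival \<Rightarrow> 'a" where
  "upper p = snd (Rep_ival p)"

definition covers :: "'a::order \<Rightarrow> 'a \<Rightarrow> bool" where
  "covers x y \<longleftrightarrow> x < y \<and> {x..y} = {x, y}"

text \<open>The incidence coalgebra; the order has to be locally finite for the sum to make sense.\<close>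

definition comult :: "('a::order ival \<Rightarrow>\<^sub>0 'k::field) \<Rightarrow> ('a ival \<times> 'a ival \<Rightarrow>\<^sub>0 'k)" where
  "comult = extend (\<lambda>p. \<Sum>c\<in>{lower p..upper p}. basis (ival (lower p) c, ival c (upper p)))"

definition counit :: "('a::order ival \<Rightarrow>\<^sub>0 'k::field) \<Rightarrow> 'k" where
  "counit = extend_scalar (\<lambda>p. if lower p = upper p then 1 else 0)"

definition counit_left :: "('a::order ival \<times> 'b \<Rightarrow>\<^sub>0 'k::field) \<Rightarrow> ('b \<Rightarrow>\<^sub>0 'k)" where
  "counit_left = extend (\<lambda>(p, q). scale (counit (basis p)) (basis q))"

definition counit_right :: "('b \<times> 'a::order ival \<Rightarrow>\<^sub>0 'k::field) \<Rightarrow> ('b \<Rightarrow>\<^sub>0 'k)" where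
  "counit_right = extend (\<lambda>(p, q). scale (counit (basis q)) (basis p))"

definition comult2 ::
  "('a::order ival \<times> 'a ival \<Rightarrow>\<^sub>0 'k::field)
    \<Rightarrow> (('a ival \<times> 'a ival) \<times> ('a ival \<times> 'a ival) \<Rightarrow>\<^sub>0 'k)" where
  "comult2 = middle_swap \<circ> tensor_map comult comult"

definition counit2 :: "('a::order ival \<times> 'a ival \<Rightarrow>\<^sub>0 'k::field) \<Rightarrow> 'k" where
  "counit2 = extend_scalar (\<lambda>(p, q). counit (basis p) * counit (basis q))"

type_synonym ('a, 'k) dd = "'a ival \<times> 'a ival \<Rightarrow>\<^sub>0 'k"

definition coalgebra_automorphism :: "(('a::order, 'k::field) dd \<Rightarrow> ('a, 'k) dd) \<Rightarrow> bool" where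
  "coalgebra_automorphism r \<longleftrightarrow>
     is_linear r \<and> bij r \<and> comult2 \<circ> r = tensor_map r r \<circ> comult2 \<and> counit2 \<circ> r = counit2"

definition braid_equation :: "(('a::order, 'k::field) dd \<Rightarrow> ('a, 'k) dd) \<Rightarrow> bool" where
  "braid_equation r \<longleftrightarrow>
     (let r12 = assoc \<circ> tensor_map r id \<circ> assoc_inv; r23 = tensor_map id r
      in r12 \<circ> r23 \<circ> r12 = r23 \<circ> r12 \<circ> r23)"

definition non_degenerate :: "(('a::order, 'k::field) dd \<Rightarrow> ('a, 'k) dd) \<Rightarrow> bool" where
  "non_degenerate r \<longleftrightarrow>
     (let \<sigma> = counit_right \<circ> r; \<tau> = counit_left \<circ> r in
      (\<exists>\<sigma>'. is_linear \<sigma>' \<and>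
         \<sigma>' \<circ> tensor_map id \<sigma> \<circ> assoc \<circ> tensor_map comult id = counit_left \<and>
         \<sigma> \<circ> tensor_map id \<sigma>' \<circ> assoc \<circ> tensor_map comult id = counit_left) \<and>
      (\<exists>\<tau>'. is_linear \<tau>' \<and>
         \<tau>' \<circ> tensor_map \<tau> id \<circ> assoc_inv \<circ> tensor_map id comult = counit_right \<and>
         \<tau> \<circ> tensor_map \<tau>' id \<circ> assoc_inv \<circ> tensor_map id comult = counit_right))"

definition non_degenerate_braided_set ::
  "(('a::order, 'k::field) dd \<Rightarrow> ('a, 'k) dd) \<Rightarrow> bool" where
  "non_degenerate_braided_set r \<longleftrightarrow>
     coalgebra_automorphism r \<and> braid_equation r \<and> non_degenerate r"

text \<open>The graph of the bijection that \<open>r\<close> induces on pairs of elements of the poset.\<close>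

definition induced ::
  "(('a::order, 'k::field) dd \<Rightarrow> ('a, 'k) dd) \<Rightarrow> 'a \<times> 'a \<Rightarrow> 'a \<times> 'a \<Rightarrow> bool" where
  "induced r = (\<lambda>(a, c) (e, g).
     r (basis (ival a a, ival c c)) = basis (ival e e, ival g g))"

text \<open>\<open>coeff r a b c d e f g h\<close> is the coefficient of \<open>(e,f) \<otimes> (g,h)\<close> in
  \<open>r ((a,b) \<otimes> (c,d))\<close>.\<close>

definition coeff ::
  "(('a::order, 'k::field) dd \<Rightarrow> ('a, 'k) dd)
    \<Rightarrow> 'a \<Rightarrow> 'a \<Rightarrow> 'a \<Rightarrow> 'a \<Rightarrow> 'a \<Rightarrow> 'a \<Rightarrow> 'a \<Rightarrow> 'a \<Rightarrow> 'k" where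
  "coeff r a b c d e f g h =
     Poly_Mapping.lookup (r (basis (ival a b, ival c d))) (ival e f, ival g h)"

text \<open>The three intervals with end points in \<open>{x, y}\<close>, numbered \<open>0, 1, 2\<close>. Matrix indices start
  at \<open>0\<close>, so a pair of intervals with numbers \<open>m\<close> and \<open>n\<close> has index \<open>3 * m + n\<close>; columns are
  inputs of \<open>r\<close> and rows are outputs.\<close>

definition ends :: "'a \<Rightarrow> 'a \<Rightarrow> nat \<Rightarrow> 'a \<times> 'a" where
  "ends x y n = [(x, x), (x, y), (y, y)] ! n"

definition coeff_matrix ::
  "(('a::order, 'k::field) dd \<Rightarrow> ('a, 'k) dd) \<Rightarrow> 'a \<Rightarrow> 'a \<Rightarrow> 'k mat" where
  "coeff_matrix r x y = mat 9 9 (\<lambda>(i, j).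
     (let (a1, b1) = ends x y (j div 3); (a2, b2) = ends x y (j mod 3);
          (a3, b3) = ends x y (i div 3); (a4, b4) = ends x y (i mod 3)
      in coeff r a1 b1 a2 b2 a3 b3 a4 b4))"

lemma lookup_scale [simp]:
  "Poly_Mapping.lookup (scale c v) b = c * Poly_Mapping.lookup v b"
  by (simp add: scale_def Poly_Mapping.map.rep_eq when_def)

lemma vector_space_scale: "vector_space (scale :: 'k::field \<Rightarrow> ('b \<Rightarrow>\<^sub>0 'k) \<Rightarrow> _)"
  by unfold_locales (rule poly_mapping_eqI; simp add: lookup_add algebra_simps)+

lemma extend_basis [simp]: "extend f (basis b) = f b"
  by (rule poly_mapping_eqI) (simp add: extend_def basis_def)

lemma tensor_vec_basis [simp]: "tensor_vec (basis b) (basis c) = basis (b, c)"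
  by (simp add: tensor_vec_def)

lemma tensor_map_basis:
  "tensor_map f g (basis (b, d)) = tensor_vec (f (basis b)) (g (basis d))"
  by (simp add: tensor_map_def)

lemma lower_upper_ival [simp]:
  assumes "a \<le> b"
  shows "lower (ival a b) = a" "upper (ival a b) = b"
  using assms by (simp_all add: lower_def upper_def ival_def Abs_ival_inverse)

lemma comult_ival:
  assumes "a \<le> b"
  shows "comult (basis (ival a b)) = (\<Sum>c\<in>{a..b}. basis (ival a c, ival c b))"
  using assms by (simp add: comult_def)

lemma counit_ival:
  assumes "a \<le> b"
  shows "counit (basis (ival a b)) = (if a = b then 1 else 0)"
  using assms by (simp add: counit_def extend_scalar_def basis_def)

end

theory Submission
  imports Defs
begin

text \<open>
  The product \<open>D \<otimes> D\<close> is the incidence coalgebra of the poset \<open>X \<times> X\<close>. Compatibility of \<open>r\<close> with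
  the comultiplication shows that \<open>r\<close> preserves the span of the nine pairs of intervals with end
  points in \<open>{x, y}\<close>: intervals of length one go to skew-primitive elements, which gives the
  shape of \<open>T\<close>, and the image of \<open>(x,y) \<otimes> (x,y)\<close> is determined by the \<open>\<alpha>\<^sub>i\<close>, the \<open>\<beta>\<^sub>i\<close> and \<open>\<Gamma>\<^sub>1\<close>,
  with the side condition \<open>\<alpha>\<^sub>1\<alpha>\<^sub>3 = \<alpha>\<^sub>2\<alpha>\<^sub>4\<close>. On this span the braid equation becomes a finite system
  of polynomial equations in these nine scalars. Six of them say that the vectors
  \<open>(\<alpha>\<^sub>i - 1)\<close> and \<open>(\<beta>\<^sub>i)\<close> are proportional, which produces \<open>C\<close>; after substituting
  \<open>\<alpha>\<^sub>i = 1 + C\<beta>\<^sub>i\<close> the remaining ones factor, and the factors are the cases of the theorem.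
\<close>

section \<open>Coefficients and comultiplication\<close>

lemma lookup_basis: "Poly_Mapping.lookup (basis b) c = (if b = c then 1 else 0)"
  by (simp add: basis_def lookup_single when_def)

text \<open>The sum may run over any finite superset of the support, since the added terms vanish.
  This puts the coordinates of vectors with different supports over one common index set.\<close>

lemma lookup_extend:
  assumes "finite S" "Poly_Mapping.keys v \<subseteq> S"
  shows "Poly_Mapping.lookup (extend f v) c
    = (\<Sum>b\<in>S. Poly_Mapping.lookup v b * Poly_Mapping.lookup (f b) c)"
proof -
  have "Poly_Mapping.lookup (extend f v) c
    = (\<Sum>b\<in>Poly_Mapping.keys v. Poly_Mapping.lookup v b * Poly_Mapping.lookup (f b) c)"
    by (simp add: extend_def lookup_sum)
  also have "\<dots> = (\<Sum>b\<in>S. Poly_Mapping.lookup v b * Poly_Mapping.lookup (f b) c)"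
    using assms by (intro sum.mono_neutral_left) (auto simp: in_keys_iff)
  finally show ?thesis .
qed

lemma extend_add: "extend f (u + v) = extend f u + extend f v"
proof (rule poly_mapping_eqI)
  fix c
  let ?S = "Poly_Mapping.keys u \<union> Poly_Mapping.keys v"
  have "Poly_Mapping.keys (u + v) \<subseteq> ?S" by (rule keys_add)
  then show "Poly_Mapping.lookup (extend f (u + v)) c
    = Poly_Mapping.lookup (extend f u + extend f v) c"
    by (simp add: lookup_extend[of ?S] lookup_add algebra_simps sum.distrib)
qed

lemma extend_zero [simp]: "extend f 0 = 0"
  by (simp add: extend_def)

lemma extend_sum: "extend f (\<Sum>a\<in>A. g a) = (\<Sum>a\<in>A. extend f (g a))"
  by (induction A rule: infinite_finite_induct) (simp_all add: extend_add)

lemma extend_scale: "extend f (scale c v) = scale c (extend f v)"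
proof (rule poly_mapping_eqI)
  fix d
  have "Poly_Mapping.keys (scale c v) \<subseteq> Poly_Mapping.keys v"
    by (auto simp: in_keys_iff)
  then show "Poly_Mapping.lookup (extend f (scale c v)) d
    = Poly_Mapping.lookup (scale c (extend f v)) d"
    by (simp add: lookup_extend[of "Poly_Mapping.keys v"] sum_distrib_left mult.assoc)
qed

lemma extend_extend: "extend g (extend f v) = extend (\<lambda>b. extend g (f b)) v"
  by (simp add: extend_def[of f] extend_def[of "\<lambda>b. extend g (f b)"] extend_sum extend_scale)

lemma lookup_tensor_vec:
  "Poly_Mapping.lookup (tensor_vec u v) (b, c)
    = Poly_Mapping.lookup u b * Poly_Mapping.lookup v c"
proof -
  have *: "Poly_Mapping.lookup (extend (\<lambda>c. basis (b', c)) v) (b, c)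
      = (if b' = b then Poly_Mapping.lookup v c else 0)" for b'
    by (cases "c \<in> Poly_Mapping.keys v")
      (auto simp: lookup_extend[OF finite_keys order_refl] lookup_basis in_keys_iff
        if_distrib[of "\<lambda>t. _ * t"] cong: if_cong)
  show ?thesis
    by (cases "b \<in> Poly_Mapping.keys u")
      (auto simp: tensor_vec_def lookup_extend[OF finite_keys order_refl, of _ u] * in_keys_iff
        if_distrib[of "\<lambda>t. _ * t"] cong: if_cong)
qed

lemma lookup_tensor_map:
  "Poly_Mapping.lookup (tensor_map f g v) (b, d)
    = (\<Sum>(p, q)\<in>Poly_Mapping.keys v. Poly_Mapping.lookup v (p, q) *
        (Poly_Mapping.lookup (f (basis p)) b * Poly_Mapping.lookup (g (basis q)) d))"
  by (simp add: tensor_map_def lookup_extend[OF finite_keys order_refl] split_def lookup_tensor_vec)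

text \<open>\<open>assoc\<close> and \<open>middle_swap\<close> only relabel basis vectors along a
  bijection, so they act on coefficients by reindexing.\<close>

lemma lookup_extend_basis_bij:
  assumes "bij \<phi>"
  shows "Poly_Mapping.lookup (extend (\<lambda>b. basis (\<phi> b)) v) (\<phi> c) = Poly_Mapping.lookup v c"
proof -
  have "\<phi> b = \<phi> c \<longleftrightarrow> b = c" for b
    using assms by (auto simp: bij_def inj_eq)
  then show ?thesis
    by (cases "c \<in> Poly_Mapping.keys v")
      (auto simp: lookup_extend[OF finite_keys order_refl] lookup_basis in_keys_iff
        if_distrib[of "\<lambda>t. _ * t"] cong: if_cong)
qed

lemma lookup_assoc:
  "Poly_Mapping.lookup (assoc v) (b, c, d) = Poly_Mapping.lookup v ((b, c), d)"
proof -
  let ?f = "\<lambda>((b, c), d). (b, c, d)"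
  have "bij ?f" by (rule o_bij[of "\<lambda>(b, c, d). ((b, c), d)"]) auto
  from lookup_extend_basis_bij[OF this, of v "((b, c), d)"] show ?thesis
    by (simp add: assoc_def case_prod_unfold)
qed

lemma lookup_middle_swap:
  "Poly_Mapping.lookup (middle_swap v) ((b, d), (c, e)) = Poly_Mapping.lookup v ((b, c), (d, e))"
proof -
  let ?f = "\<lambda>((b, c), (d, e)). ((b, d), (c, e))"
  have "bij ?f" by (rule o_bij[of ?f]) auto
  from lookup_extend_basis_bij[OF this, of v "((b, c), (d, e))"] show ?thesis
    by (simp add: middle_swap_def case_prod_unfold)
qed

lemma ival_cases [cases type: ival]:
  obtains a b where "p = ival a b" "a \<le> b"
  by (cases p) (auto simp: ival_def)

lemma ival_eq_iff:
  assumes "a \<le> b" "c \<le> d"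
  shows "ival a b = ival c d \<longleftrightarrow> a = c \<and> b = d"
  by (metis assms lower_upper_ival)

text \<open>A pair of intervals determines its splitting point, so at most one summand of the
  comultiplication contributes. All four end points stay free, so every basis vector of D \<otimes>
  D is covered.\<close>

lemma lookup_comult_ival:
  assumes "finite {a..b}" "a \<le> b" "c \<le> m" "m' \<le> d"
  shows "Poly_Mapping.lookup (comult (basis (ival a b))) (ival c m, ival m' d)
    = (if m = m' \<and> a = c \<and> b = d then 1 else (0 :: 'k::field))"
proof -
  have "Poly_Mapping.lookup (comult (basis (ival a b))) (ival c m, ival m' d)
    = (\<Sum>e\<in>{a..b}. if e = m then (if m = m' \<and> a = c \<and> b = d then 1 else (0 :: 'k)) else 0)"
    using assms unfolding comult_ival[OF assms(2)] lookup_sum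
    by (intro sum.cong) (auto simp: lookup_basis ival_eq_iff)
  also have "\<dots> = (if m = m' \<and> a = c \<and> b = d then 1 else 0)"
    using assms by auto
  finally show ?thesis .
qed

text \<open>This is the comultiplication of the incidence coalgebra of X \<times> X in coordinates:
  the interval from \<open>(e, g)\<close> to \<open>(f, h)\<close> is split at the point
  \<open>(m, n)\<close>.\<close>

lemma lookup_comult2:
  fixes v :: "('a::order, 'k::field) dd"
  assumes fin: "\<And>a b :: 'a. finite {a..b}"
    and le: "e \<le> m" "m' \<le> f" "g \<le> n" "n' \<le> h"
  shows "Poly_Mapping.lookup (comult2 v) ((ival e m, ival g n), (ival m' f, ival n' h))
    = (if m = m' \<and> n = n' then Poly_Mapping.lookup v (ival e f, ival g h) else 0)"
proof -
  have "Poly_Mapping.lookup (comult2 v) ((ival e m, ival g n), (ival m' f, ival n' h))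
    = (\<Sum>pq\<in>Poly_Mapping.keys v. if pq = (ival e f, ival g h) then
        (if m = m' \<and> n = n' then Poly_Mapping.lookup v (ival e f, ival g h) else 0) else 0)"
    unfolding comult2_def comp_def lookup_middle_swap lookup_tensor_map
  proof (rule sum.cong[OF refl])
    fix pq :: "'a ival \<times> 'a ival"
    obtain a b c d where "pq = (ival a b, ival c d)" "a \<le> b" "c \<le> d"
      by (metis surj_pair ival_cases)
    then show "(case pq of (p, q) \<Rightarrow> Poly_Mapping.lookup v (p, q) *
        (Poly_Mapping.lookup (comult (basis p)) (ival e m, ival m' f) *
          Poly_Mapping.lookup (comult (basis q)) (ival g n, ival n' h)))
      = (if pq = (ival e f, ival g h) then
        (if m = m' \<and> n = n' then Poly_Mapping.lookup v (ival e f, ival g h) else 0) else 0)"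
      \<comment> \<open>If the middle points agree, transitivity makes \<open>ival e f\<close> and
        \<open>ival g h\<close> genuine intervals, as \<open>ival_eq_iff\<close> requires. If they
        differ, these terms may be meaningless, but both sides are zero.\<close>
      using le order_trans[of e m f] order_trans[of g n h]
      by (auto simp: lookup_comult_ival[OF fin] ival_eq_iff)
  qed
  also have "\<dots> = (if m = m' \<and> n = n' then Poly_Mapping.lookup v (ival e f, ival g h) else 0)"
    by (simp add: in_keys_iff)
  finally show ?thesis .
qed

lemma comult2_basis_ival:
  assumes "a \<le> b" "c \<le> d"
  shows "comult2 (basis (ival a b, ival c d))
    = (\<Sum>s\<in>{a..b}. \<Sum>t\<in>{c..d}. basis ((ival a s, ival c t), (ival s b, ival t d)))"
  using assms
  by (simp add: comult2_def tensor_map_basis comult_ival tensor_vec_def extend_sum middle_swap_def)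

text \<open>The two sides of the compatibility of \<open>r\<close> with the comultiplication are
  compared at one basis vector. Outputs whose middle points differ are kept, because the vanishing
  of the left side there yields relations too.\<close>

lemma coeff_comult:
  assumes fin: "\<And>a b :: 'a::order. finite {a..b}"
    and aut: "coalgebra_automorphism (r :: ('a, 'k::field) dd \<Rightarrow> ('a, 'k) dd)"
    and le: "a \<le> b" "c \<le> d" "e \<le> m" "m' \<le> f" "g \<le> n" "n' \<le> h"
  shows "(if m = m' \<and> n = n' then coeff r a b c d e f g h else 0)
    = (\<Sum>s\<in>{a..b}. \<Sum>t\<in>{c..d}. coeff r a s c t e m g n * coeff r s b t d m' f n' h)"
proof -
  have "comult2 (r (basis (ival a b, ival c d)))
      = tensor_map r r (comult2 (basis (ival a b, ival c d)))"
    using aut unfolding coalgebra_automorphism_def by (metis comp_apply)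
  also have "\<dots> = (\<Sum>s\<in>{a..b}. \<Sum>t\<in>{c..d}.
      tensor_vec (r (basis (ival a s, ival c t))) (r (basis (ival s b, ival t d))))"
    by (simp add: comult2_basis_ival le(1,2) tensor_map_def extend_sum)
  finally have "Poly_Mapping.lookup (comult2 (r (basis (ival a b, ival c d))))
        ((ival e m, ival g n), (ival m' f, ival n' h))
      = (\<Sum>s\<in>{a..b}. \<Sum>t\<in>{c..d}. coeff r a s c t e m g n * coeff r s b t d m' f n' h)"
    by (simp add: lookup_sum lookup_tensor_vec coeff_def)
  then show ?thesis
    by (simp only: lookup_comult2[OF fin le(3-6)] coeff_def)
qed

lemma coeff_induced:
  assumes "induced r (a, c) (p, q)" "e \<le> f" "g \<le> h"
  shows "coeff r a a c c e f g h = (if e = p \<and> f = p \<and> g = q \<and> h = q then 1 else 0)"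
  using assms by (auto simp: induced_def coeff_def lookup_basis ival_eq_iff)

section \<open>Images of the intervals between \<open>x\<close> and \<open>y\<close>\<close>

text \<open>If an interval of length one in \<open>X \<times> X\<close> has end points whose images are \<open>(p, q)\<close> and
  \<open>(p', q')\<close>, then its image \<open>z\<close> satisfies \<open>\<Delta> z = (p, q) \<otimes> z + z \<otimes> (p', q')\<close>, which is assumption
  \<open>z\<close> in coordinates.\<close>

lemma coeff_skew_primitive:
  fixes z :: "'a::order \<Rightarrow> 'a \<Rightarrow> 'a \<Rightarrow> 'a \<Rightarrow> 'k::field"
  assumes z: "\<And>e m m' f g n n' h. e \<le> m \<Longrightarrow> m' \<le> f \<Longrightarrow> g \<le> n \<Longrightarrow> n' \<le> h \<Longrightarrow>
      (if m = m' \<and> n = n' then z e f g h else 0)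
      = (if e = p \<and> m = p \<and> g = q \<and> n = q then z m' f n' h else 0)
        + (if m' = p' \<and> f = p' \<and> n' = q' \<and> h = q' then z e m g n else 0)"
    and ne: "(p, q) \<noteq> (p', q')" and le: "e \<le> f" "g \<le> h"
  shows "z e f g h =
    (if e = p \<and> f = p' \<and> g = q \<and> h = q' then z p p' q q'
     else if e = p \<and> f = p \<and> g = q \<and> h = q then z p p q q
     else if e = p' \<and> f = p' \<and> g = q' \<and> h = q' then - z p p q q else 0)"
proof -
  \<comment> \<open>This is the coordinate at the point \<open>(p, q)\<close> tensor the point
    \<open>(p', q')\<close>; the left side of \<open>z\<close> is zero there because the two points
    differ.\<close>
  have "z p' p' q' q' = - z p p q q"
    using z[of p p p' p' q q q' q'] ne by (auto split: if_splits simp: eq_neg_iff_add_eq_0 add.commute)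
  \<comment> \<open>An interval in the support is split at its lower and at its upper end. The first
    split forces it to start at \<open>(p, q)\<close> or to be the point \<open>(p', q')\<close>,
    the second to end at \<open>(p', q')\<close> or to be the point \<open>(p, q)\<close>.\<close>
  then show ?thesis
    using z[of e e e f g g g h] z[of e f f f g h h h] ne le by (auto split: if_splits)
qed

text \<open>On the four pairs of points from {x, y} the map \<open>r\<close> is the flip. The
  scalars are parameters tied to \<open>r\<close> by equations, so that the theorem can instantiate
  the locale with its own variables.\<close>

locale flip_square =
  fixes r :: "('a::order, 'k::field) dd \<Rightarrow> ('a, 'k) dd" and x y :: 'a
  assumes fin: "\<And>a b :: 'a. finite {a..b}"
    and aut: "coalgebra_automorphism r" and braid: "braid_equation r"
    and cover: "covers x y"
    and xx: "induced r (x, x) (x, x)" and xy: "induced r (x, y) (y, x)"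
    and yx: "induced r (y, x) (x, y)" and yy: "induced r (y, y) (y, y)"
  fixes \<alpha>\<^sub>1 \<alpha>\<^sub>2 \<alpha>\<^sub>3 \<alpha>\<^sub>4 \<beta>\<^sub>1 \<beta>\<^sub>2 \<beta>\<^sub>3 \<beta>\<^sub>4 A B\<^sub>1 B\<^sub>2 B\<^sub>3 B\<^sub>4 \<Gamma>\<^sub>1 \<Gamma>\<^sub>2 \<Gamma>\<^sub>3 \<Gamma>\<^sub>4 :: 'k
  assumes alpha: "\<alpha>\<^sub>1 = coeff r x x x y x y x x" "\<alpha>\<^sub>2 = coeff r x y x x x x x y"
      "\<alpha>\<^sub>3 = coeff r x y y y y y x y" "\<alpha>\<^sub>4 = coeff r y y x y x y y y"
    and beta: "\<beta>\<^sub>1 = coeff r x x x y x x x x" "\<beta>\<^sub>2 = coeff r x y x x x x x x"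
      "\<beta>\<^sub>3 = coeff r x y y y y y x x" "\<beta>\<^sub>4 = coeff r y y x y x x y y"
    and ABGamma: "A = coeff r x y x y x y x y"
      "B\<^sub>1 = coeff r x y x y x x x y" "B\<^sub>2 = coeff r x y x y x y x x"
      "B\<^sub>3 = coeff r x y x y x y y y" "B\<^sub>4 = coeff r x y x y y y x y"
      "\<Gamma>\<^sub>1 = coeff r x y x y x x x x" "\<Gamma>\<^sub>2 = coeff r x y x y x x y y"
      "\<Gamma>\<^sub>3 = coeff r x y x y y y x x" "\<Gamma>\<^sub>4 = coeff r x y x y y y y y"
begin


lemma interval: "{x..y} = {x, y}" and neq [simp]: "x \<noteq> y" "y \<noteq> x"
  and le [simp]: "x \<le> y" "\<not> y \<le> x"
  using cover by (auto simp: covers_def)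

lemmas coeff_points = coeff_induced[OF xx] coeff_induced[OF xy] coeff_induced[OF yx] coeff_induced[OF yy]

lemmas comult_rule = coeff_comult[OF fin aut]

text \<open>In X \<times> X the point (x,y) covers (x,x), so the comultiplication of this basis
  vector has two terms, and \<open>coeff_skew_primitive\<close> applies with the images (x,x) and
  (y,x) of the end points. The next three lemmas treat the other covers of the square in the same
  way.\<close>

lemma coeff_xxxy:
  assumes "e \<le> f" "g \<le> h"
  shows "coeff r x x x y e f g h =
    (if e = x \<and> f = y \<and> g = x \<and> h = x then \<alpha>\<^sub>1
     else if e = x \<and> f = x \<and> g = x \<and> h = x then \<beta>\<^sub>1
     else if e = y \<and> f = y \<and> g = x \<and> h = x then - \<beta>\<^sub>1 else 0)"
  unfolding alpha beta
  by (rule coeff_skew_primitive[OF _ _ assms])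
    (subst comult_rule; simp add: interval coeff_points; fail | simp)+

lemma coeff_xyxx:
  assumes "e \<le> f" "g \<le> h"
  shows "coeff r x y x x e f g h =
    (if e = x \<and> f = x \<and> g = x \<and> h = y then \<alpha>\<^sub>2
     else if e = x \<and> f = x \<and> g = x \<and> h = x then \<beta>\<^sub>2
     else if e = x \<and> f = x \<and> g = y \<and> h = y then - \<beta>\<^sub>2 else 0)"
  unfolding alpha beta
  by (rule coeff_skew_primitive[OF _ _ assms])
    (subst comult_rule; simp add: interval coeff_points; fail | simp)+

lemma coeff_xyyy:
  assumes "e \<le> f" "g \<le> h"
  shows "coeff r x y y y e f g h =
    (if e = y \<and> f = y \<and> g = x \<and> h = y then \<alpha>\<^sub>3
     else if e = y \<and> f = y \<and> g = x \<and> h = x then \<beta>\<^sub>3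
     else if e = y \<and> f = y \<and> g = y \<and> h = y then - \<beta>\<^sub>3 else 0)"
  unfolding alpha beta
  by (rule coeff_skew_primitive[OF _ _ assms])
    (subst comult_rule; simp add: interval coeff_points; fail | simp)+

lemma coeff_yyxy:
  assumes "e \<le> f" "g \<le> h"
  shows "coeff r y y x y e f g h =
    (if e = x \<and> f = y \<and> g = y \<and> h = y then \<alpha>\<^sub>4
     else if e = x \<and> f = x \<and> g = y \<and> h = y then \<beta>\<^sub>4
     else if e = y \<and> f = y \<and> g = y \<and> h = y then - \<beta>\<^sub>4 else 0)"
  unfolding alpha beta
  by (rule coeff_skew_primitive[OF _ _ assms])
    (subst comult_rule; simp add: interval coeff_points; fail | simp)+

text \<open>The square from (x,x) to (y,y) has four points, which give the four summands. In the
  outer two one factor is a point; in the inner two both factors are covers and hence already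
  known.\<close>

lemma comult_xyxy:
  assumes "e \<le> m" "m' \<le> f" "g \<le> n" "n' \<le> h"
  shows "(if m = m' \<and> n = n' then coeff r x y x y e f g h else 0)
    = (if e = x \<and> m = x \<and> g = x \<and> n = x then coeff r x y x y m' f n' h else 0)
      + coeff r x x x y e m g n * coeff r x y y y m' f n' h
      + coeff r x y x x e m g n * coeff r y y x y m' f n' h
      + (if m' = y \<and> f = y \<and> n' = y \<and> h = y then coeff r x y x y e m g n else 0)"
  by (subst comult_rule) (use assms in \<open>auto simp add: interval coeff_points\<close>)

text \<open>Each identity is one coordinate of \<open>comult_xyxy\<close>. Splitting the output
  (x,y) \<otimes> (x,y) at (y,x) and at (x,y) computes \<open>A\<close> in two ways, whence the side
  condition on the \<alpha>. The last identity comes from different middle points, where the left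
  side is zero; it ties \<open>\<Gamma>\<^sub>4\<close> to \<open>\<Gamma>\<^sub>1\<close>.\<close>

lemma xyxy_relations:
  shows "A = \<alpha>\<^sub>1 * \<alpha>\<^sub>3"
    and "\<alpha>\<^sub>1 * \<alpha>\<^sub>3 = \<alpha>\<^sub>2 * \<alpha>\<^sub>4"
    and "B\<^sub>1 = \<alpha>\<^sub>2 * \<beta>\<^sub>4" "B\<^sub>2 = \<alpha>\<^sub>1 * \<beta>\<^sub>3"
    and "B\<^sub>3 = - \<alpha>\<^sub>4 * \<beta>\<^sub>2" "B\<^sub>4 = - \<alpha>\<^sub>3 * \<beta>\<^sub>1"
    and "\<Gamma>\<^sub>2 = - \<beta>\<^sub>2 * \<beta>\<^sub>4" "\<Gamma>\<^sub>3 = - \<beta>\<^sub>1 * \<beta>\<^sub>3"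
    and "\<Gamma>\<^sub>4 = \<beta>\<^sub>1 * \<beta>\<^sub>3 + \<beta>\<^sub>2 * \<beta>\<^sub>4 - \<Gamma>\<^sub>1"
proof -
  note simps = coeff_xxxy coeff_xyxx coeff_xyyy coeff_yyxy ABGamma algebra_simps
  show "A = \<alpha>\<^sub>1 * \<alpha>\<^sub>3"
    using comult_xyxy[of x y y y x x x y] by (simp add: simps)
  moreover have "A = \<alpha>\<^sub>2 * \<alpha>\<^sub>4"
    using comult_xyxy[of x x x y x y y y] by (simp add: simps)
  ultimately show "\<alpha>\<^sub>1 * \<alpha>\<^sub>3 = \<alpha>\<^sub>2 * \<alpha>\<^sub>4" by simp
  show "B\<^sub>1 = \<alpha>\<^sub>2 * \<beta>\<^sub>4"
    using comult_xyxy[of x x x x x y y y] by (simp add: simps)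
  show "B\<^sub>2 = \<alpha>\<^sub>1 * \<beta>\<^sub>3"
    using comult_xyxy[of x y y y x x x x] by (simp add: simps)
  show "B\<^sub>3 = - \<alpha>\<^sub>4 * \<beta>\<^sub>2"
    using comult_xyxy[of x x x y y y y y] by (simp add: simps)
  show "B\<^sub>4 = - \<alpha>\<^sub>3 * \<beta>\<^sub>1"
    using comult_xyxy[of y y y y x x x y] by (simp add: simps)
  show "\<Gamma>\<^sub>2 = - \<beta>\<^sub>2 * \<beta>\<^sub>4"
    using comult_xyxy[of x x x x y y y y] by (simp add: simps)
  show "\<Gamma>\<^sub>3 = - \<beta>\<^sub>1 * \<beta>\<^sub>3"
    using comult_xyxy[of y y y y x x x x] by (simp add: simps)
  show "\<Gamma>\<^sub>4 = \<beta>\<^sub>1 * \<beta>\<^sub>3 + \<beta>\<^sub>2 * \<beta>\<^sub>4 - \<Gamma>\<^sub>1"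
    using comult_xyxy[of x x y y x x y y]
    by (simp add: simps)
qed

text \<open>Splitting at the lower end shows that an interval of the support starts at (x,x) or
  lives on {x, y}, because the images of the covers do. Splitting at the upper end does the same
  with (y,y).\<close>

lemma coeff_xyxy_eq_0:
  assumes "e \<le> f" "g \<le> h" "{e, f, g, h} - {x, y} \<noteq> {}"
  shows "coeff r x y x y e f g h = 0"
  using comult_xyxy[of e e e f g g g h] comult_xyxy[of e f f f g h h h] assms
  by (auto simp: coeff_xxxy[of e e] coeff_xyxx[of e e] coeff_xyyy[of f f] coeff_yyxy[of f f] split: if_splits)

end

section \<open>The braid equation\<close>

lemma keys_triple:
  assumes "\<And>l m n. (l, m, n) \<notin> S \<times> S \<times> S \<Longrightarrow> Poly_Mapping.lookup v (l, m, n) = 0"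
  shows "Poly_Mapping.keys v \<subseteq> S \<times> S \<times> S"
  using assms by (auto simp: in_keys_iff)

text \<open>Only the input must be supported in \<open>S\<close>; the output coordinates are
  arbitrary, so the same formula also shows that the output stays inside \<open>S\<close>.\<close>

lemma lookup_r12:
  assumes S: "finite S" "Poly_Mapping.keys v \<subseteq> S \<times> S \<times> S"
  shows "Poly_Mapping.lookup ((assoc \<circ> tensor_map r id \<circ> assoc_inv) v) (l, m, n)
    = (\<Sum>a\<in>S. \<Sum>b\<in>S. Poly_Mapping.lookup v (a, b, n)
        * Poly_Mapping.lookup (r (basis (a, b))) (l, m))"
proof -
  have "Poly_Mapping.lookup ((assoc \<circ> tensor_map r id \<circ> assoc_inv) v) (l, m, n)
    = (\<Sum>(a, b, c)\<in>S \<times> S \<times> S. Poly_Mapping.lookup v (a, b, c)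
        * (Poly_Mapping.lookup (r (basis (a, b))) (l, m) * Poly_Mapping.lookup (basis c) n))"
    using S by (simp add: lookup_assoc assoc_inv_def tensor_map_def extend_extend case_prod_unfold
        lookup_extend[of "S \<times> S \<times> S"] lookup_tensor_vec)
  also have "\<dots> = (\<Sum>a\<in>S. \<Sum>b\<in>S. \<Sum>c\<in>S. if c = n then Poly_Mapping.lookup v (a, b, c)
        * Poly_Mapping.lookup (r (basis (a, b))) (l, m) else 0)"
    unfolding sum.cartesian_product by (intro sum.cong) (auto simp: lookup_basis)
  also have "\<dots> = (\<Sum>a\<in>S. \<Sum>b\<in>S. Poly_Mapping.lookup v (a, b, n)
        * Poly_Mapping.lookup (r (basis (a, b))) (l, m))"
    using S by (intro sum.cong) (auto simp: in_keys_iff subset_iff)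
  finally show ?thesis .
qed

lemma lookup_r23:
  assumes S: "finite S" "Poly_Mapping.keys v \<subseteq> S \<times> S \<times> S"
  shows "Poly_Mapping.lookup (tensor_map id r v) (l, m, n)
    = (\<Sum>b\<in>S. \<Sum>c\<in>S. Poly_Mapping.lookup v (l, b, c)
        * Poly_Mapping.lookup (r (basis (b, c))) (m, n))"
proof -
  have "Poly_Mapping.lookup (tensor_map id r v) (l, m, n)
    = (\<Sum>(a, b, c)\<in>S \<times> S \<times> S. Poly_Mapping.lookup v (a, b, c)
        * (Poly_Mapping.lookup (basis a) l * Poly_Mapping.lookup (r (basis (b, c))) (m, n)))"
    using S by (simp add: tensor_map_def case_prod_unfold
        lookup_extend[of "S \<times> S \<times> S"] lookup_tensor_vec)
  also have "\<dots> = (\<Sum>a\<in>S. if a = l then \<Sum>b\<in>S. \<Sum>c\<in>S. Poly_Mapping.lookup v (a, b, c)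
        * Poly_Mapping.lookup (r (basis (b, c))) (m, n) else 0)"
    unfolding sum.cartesian_product[symmetric]
    by (intro sum.cong) (auto simp: lookup_basis)
  also have "\<dots> = (\<Sum>b\<in>S. \<Sum>c\<in>S. Poly_Mapping.lookup v (l, b, c)
        * Poly_Mapping.lookup (r (basis (b, c))) (m, n))"
  proof (cases "l \<in> S")
    case False
    then have "Poly_Mapping.lookup v (l, b, c) = 0" for b c
      using S by (auto simp: in_keys_iff subset_iff)
    then show ?thesis using S by simp
  qed (use S in simp)
  finally show ?thesis .
qed

text \<open>The braid equation is evaluated at one basis triple. Each side has three crossings, and
  the summation indices \<open>a\<close>, \<open>b\<close>, \<open>c\<close> label the three inner
  strands of the braid diagram.\<close>

lemma braid_coefficients:
  fixes r :: "('a::order, 'k::field) dd \<Rightarrow> ('a, 'k) dd"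
  defines "R \<equiv> \<lambda>p q s t. Poly_Mapping.lookup (r (basis (p, q))) (s, t)"
  assumes braid: "braid_equation r" and S: "finite S"
    and closed: "\<And>p q s t. p \<in> S \<Longrightarrow> q \<in> S \<Longrightarrow> (s, t) \<notin> S \<times> S \<Longrightarrow> R p q s t = 0"
    and pqs: "p \<in> S" "q \<in> S" "s \<in> S"
  shows "(\<Sum>a\<in>S. \<Sum>b\<in>S. \<Sum>c\<in>S. R p q a b * R b s c n * R a c l m)
       = (\<Sum>a\<in>S. \<Sum>b\<in>S. \<Sum>c\<in>S. R q s b c * R p b l a * R a c m n)"
proof -
  define r12 :: "('a ival \<times> 'a ival \<times> 'a ival \<Rightarrow>\<^sub>0 'k) \<Rightarrow> _" where
    "r12 = assoc \<circ> tensor_map r id \<circ> assoc_inv"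
  define r23 :: "('a ival \<times> 'a ival \<times> 'a ival \<Rightarrow>\<^sub>0 'k) \<Rightarrow> _" where
    "r23 = tensor_map id r"
  let ?b = "basis (p, q, s) :: 'a ival \<times> 'a ival \<times> 'a ival \<Rightarrow>\<^sub>0 'k"
  let ?K = "\<lambda>v :: 'a ival \<times> 'a ival \<times> 'a ival \<Rightarrow>\<^sub>0 'k. Poly_Mapping.keys v \<subseteq> S \<times> S \<times> S"
  have l12: "Poly_Mapping.lookup (r12 v) (l, m, n)
      = (\<Sum>a\<in>S. \<Sum>b\<in>S. Poly_Mapping.lookup v (a, b, n) * R a b l m)" if "?K v" for v l m n
    unfolding r12_def R_def by (rule lookup_r12[OF S that])
  have l23: "Poly_Mapping.lookup (r23 v) (l, m, n)
      = (\<Sum>b\<in>S. \<Sum>c\<in>S. Poly_Mapping.lookup v (l, b, c) * R b c m n)" if "?K v" for v l m n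
    unfolding r23_def R_def by (rule lookup_r23[OF S that])
  have zero: "Poly_Mapping.lookup v (a, b, c) = 0" if "?K v" "(a, b, c) \<notin> S \<times> S \<times> S" for v a b c
    using that by (auto simp: in_keys_iff subset_iff)
  \<comment> \<open>Since \<open>S\<close> is closed under \<open>r\<close>, supports stay inside
    \<open>S \<times> S \<times> S\<close>, so the lookup formulas apply again after every
    crossing.\<close>
  have k12: "?K (r12 v)" if v: "?K v" for v
  proof (rule keys_triple)
    fix l m n assume "(l, m, n) \<notin> S \<times> S \<times> S"
    then show "Poly_Mapping.lookup (r12 v) (l, m, n) = 0"
      by (auto simp: l12[OF v] intro!: sum.neutral closed zero[OF v])
  qed
  have k23: "?K (r23 v)" if v: "?K v" for v
  proof (rule keys_triple)
    fix l m n assume "(l, m, n) \<notin> S \<times> S \<times> S"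
    then show "Poly_Mapping.lookup (r23 v) (l, m, n) = 0"
      by (auto simp: l23[OF v] intro!: sum.neutral closed zero[OF v])
  qed
  have b: "?K ?b" using pqs by (simp add: basis_def)
  have f: "Poly_Mapping.lookup (r12 ?b) (a, b, c) = (if c = s then R p q a b else 0)" for a b c
  proof -
    have "Poly_Mapping.lookup (r12 ?b) (a, b, c)
      = (\<Sum>a'\<in>S. if a' = p then \<Sum>b'\<in>S. if b' = q then (if c = s then R p q a b else 0) else 0 else 0)"
      unfolding l12[OF b] by (intro sum.cong) (auto simp: lookup_basis intro!: sum.cong sum.neutral)
    then show ?thesis using S pqs by simp
  qed
  have g: "Poly_Mapping.lookup (r23 ?b) (a, b, c) = (if a = p then R q s b c else 0)" for a b c
  proof -
    have "Poly_Mapping.lookup (r23 ?b) (a, b, c)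
      = (\<Sum>b'\<in>S. if b' = q then \<Sum>c'\<in>S. if c' = s then (if a = p then R q s b c else 0) else 0 else 0)"
      unfolding l23[OF b] by (intro sum.cong) (auto simp: lookup_basis intro!: sum.cong sum.neutral)
    then show ?thesis using S pqs by simp
  qed
  have f2: "Poly_Mapping.lookup (r23 (r12 ?b)) (a, c, n) = (\<Sum>b\<in>S. R p q a b * R b s c n)" for a c n
  proof -
    have "Poly_Mapping.lookup (r23 (r12 ?b)) (a, c, n)
      = (\<Sum>b\<in>S. \<Sum>s'\<in>S. if s' = s then R p q a b * R b s c n else 0)"
      unfolding l23[OF k12[OF b]] f by (intro sum.cong) auto
    then show ?thesis using S pqs by simp
  qed
  have g2: "Poly_Mapping.lookup (r12 (r23 ?b)) (l, a, c) = (\<Sum>b\<in>S. R q s b c * R p b l a)" for l a c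
  proof -
    have "Poly_Mapping.lookup (r12 (r23 ?b)) (l, a, c)
      = (\<Sum>p'\<in>S. if p' = p then \<Sum>b\<in>S. R q s b c * R p b l a else 0)"
      unfolding l12[OF k23[OF b]] g by (intro sum.cong) auto
    then show ?thesis using S pqs by simp
  qed
  have "(\<Sum>a\<in>S. \<Sum>b\<in>S. \<Sum>c\<in>S. R p q a b * R b s c n * R a c l m)
      = (\<Sum>a\<in>S. \<Sum>c\<in>S. \<Sum>b\<in>S. R p q a b * R b s c n * R a c l m)"
    by (rule sum.cong[OF refl sum.swap])
  also have "\<dots> = Poly_Mapping.lookup (r12 (r23 (r12 ?b))) (l, m, n)"
    by (simp add: l12[OF k23[OF k12[OF b]]] f2 sum_distrib_right)
  also have "r12 (r23 (r12 ?b)) = r23 (r12 (r23 ?b))"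
    using braid unfolding braid_equation_def Let_def r12_def[symmetric] r23_def[symmetric]
    by (metis comp_apply)
  also have "Poly_Mapping.lookup \<dots> (l, m, n)
      = (\<Sum>a\<in>S. \<Sum>c\<in>S. \<Sum>b\<in>S. R q s b c * R p b l a * R a c m n)"
    by (simp add: l23[OF k12[OF k23[OF b]]] g2 sum_distrib_right)
  also have "\<dots> = (\<Sum>a\<in>S. \<Sum>b\<in>S. \<Sum>c\<in>S. R q s b c * R p b l a * R a c m n)"
    by (rule sum.cong[OF refl sum.swap])
  finally show ?thesis .
qed

text \<open>Linearity and injectivity would carry the equation over to the basis vectors, and there
  the coordinate at \<open>u\<close> reads 1 = 0.\<close>

lemma linear_inj_basis:
  assumes "is_linear r" "inj r" "u \<noteq> v" "u \<noteq> w"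
  shows "r (basis u) \<noteq> scale c (r (basis v)) - scale c (r (basis w))"
proof
  interpret Vector_Spaces.linear scale scale r by fact
  assume "r (basis u) = scale c (r (basis v)) - scale c (r (basis w))"
  then have "r (basis u) = r (scale c (basis v) - scale c (basis w))"
    by (simp add: diff scale)
  then have "basis u = scale c (basis v) - scale c (basis w)"
    using assms(2) by (simp add: inj_eq)
  then have "Poly_Mapping.lookup (basis u) u
      = Poly_Mapping.lookup (scale c (basis v) - scale c (basis w)) u"
    by simp
  with assms(3,4) show False by (simp add: lookup_basis lookup_minus)
qed

lemma dd_eqI:
  fixes u v :: "('a::order, 'k::field) dd"
  assumes "\<And>e f g h. e \<le> f \<Longrightarrow> g \<le> h \<Longrightarrow>
    Poly_Mapping.lookup u (ival e f, ival g h) = Poly_Mapping.lookup v (ival e f, ival g h)"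
  shows "u = v"
  using assms by (intro poly_mapping_eqI) (metis surj_pair ival_cases)

text \<open>If \<open>A\<close> were zero, the image of the cover would be \<open>B\<close> times
  the difference of the images of its end points, contradicting the injectivity of
  \<open>r\<close>.\<close>

lemma coeff_nonzero:
  fixes r :: "('a::order, 'k::field) dd \<Rightarrow> ('a, 'k) dd"
  assumes r: "is_linear r" "inj r"
    and coeff: "\<And>e f g h. e \<le> f \<Longrightarrow> g \<le> h \<Longrightarrow> coeff r a b c d e f g h =
      (if e = p \<and> f = p' \<and> g = q \<and> h = q' then A
       else if e = p \<and> f = p \<and> g = q \<and> h = q then B
       else if e = p' \<and> f = p' \<and> g = q' \<and> h = q' then - B else 0)"
    and points: "induced r (a, c) (p, q)" "induced r (b, d) (p', q')"
    and ne: "(a, c) \<noteq> (b, d)" "(p, q) \<noteq> (p', q')" and le: "a \<le> b" "c \<le> d"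
  shows "A \<noteq> 0"
proof
  assume A: "A = 0"
  have "r (basis (ival a b, ival c d))
      = scale B (r (basis (ival a a, ival c c))) - scale B (r (basis (ival b b, ival d d)))"
  proof (rule dd_eqI)
    fix e f g h :: 'a assume *: "e \<le> f" "g \<le> h"
    show "Poly_Mapping.lookup (r (basis (ival a b, ival c d))) (ival e f, ival g h)
      = Poly_Mapping.lookup (scale B (r (basis (ival a a, ival c c)))
          - scale B (r (basis (ival b b, ival d d)))) (ival e f, ival g h)"
      using coeff[OF *] coeff_induced[OF points(1) *] coeff_induced[OF points(2) *] A ne
      by (auto simp: coeff_def lookup_minus split: if_splits)
  qed
  then show False
    using linear_inj_basis[OF r] ne le by (auto simp: ival_eq_iff)
qed

context flip_square
begin

lemma alpha_nonzero: "\<alpha>\<^sub>1 \<noteq> 0" "\<alpha>\<^sub>2 \<noteq> 0" "\<alpha>\<^sub>3 \<noteq> 0" "\<alpha>\<^sub>4 \<noteq> 0"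
proof -
  have r: "is_linear r" "inj r"
    using aut by (auto simp: coalgebra_automorphism_def bij_def)
  show "\<alpha>\<^sub>1 \<noteq> 0" by (rule coeff_nonzero[OF r coeff_xxxy xx xy]) simp_all
  show "\<alpha>\<^sub>2 \<noteq> 0" by (rule coeff_nonzero[OF r coeff_xyxx xx yx]) simp_all
  show "\<alpha>\<^sub>3 \<noteq> 0" by (rule coeff_nonzero[OF r coeff_xyyy xy yy]) simp_all
  show "\<alpha>\<^sub>4 \<noteq> 0" by (rule coeff_nonzero[OF r coeff_yyxy yx yy]) simp_all
qed

lemmas coeff_tables =
  coeff_points coeff_xxxy coeff_xyxx coeff_xyyy coeff_yyxy ABGamma[symmetric]

text \<open>Only the shape is claimed. The column of (x,y) \<otimes> (x,y) consists of nine named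
  scalars; the zeros elsewhere come from the skew-primitive images of the covers and from the flip
  on points.\<close>

lemma coeff_matrix_eq:
  "coeff_matrix r x y = mat_of_rows_list 9
    [[1,  \<beta>\<^sub>1, 0,  \<beta>\<^sub>2, \<Gamma>\<^sub>1,   0, 0,   0, 0],
     [0,   0, 0,  \<alpha>\<^sub>2, B\<^sub>1,   0, 0,   0, 0],
     [0,   0, 0, -\<beta>\<^sub>2, \<Gamma>\<^sub>2,   0, 1,  \<beta>\<^sub>4, 0],
     [0,  \<alpha>\<^sub>1, 0,   0, B\<^sub>2,   0, 0,   0, 0],
     [0,   0, 0,   0,  A,   0, 0,   0, 0],
     [0,   0, 0,   0, B\<^sub>3,   0, 0,  \<alpha>\<^sub>4, 0],
     [0, -\<beta>\<^sub>1, 1,   0, \<Gamma>\<^sub>3,  \<beta>\<^sub>3, 0,   0, 0],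
     [0,   0, 0,   0, B\<^sub>4,  \<alpha>\<^sub>3, 0,   0, 0],
     [0,   0, 0,   0, \<Gamma>\<^sub>4, -\<beta>\<^sub>3, 0, -\<beta>\<^sub>4, 1]]"
    (is "_ = ?T")
proof (rule eq_matI)
  fix i j assume "i < dim_row ?T" "j < dim_col ?T"
  then have "i \<in> {0, 1, 2, 3, 4, 5, 6, 7, 8}" "j \<in> {0, 1, 2, 3, 4, 5, 6, 7, 8}"
    by (auto simp: mat_of_rows_list_def)
  then show "coeff_matrix r x y $$ (i, j) = ?T $$ (i, j)"
    by (elim insertE emptyE)
      (simp_all add: coeff_matrix_def mat_of_rows_list_def ends_def coeff_tables)
qed (simp_all add: coeff_matrix_def mat_of_rows_list_def)

text \<open>Comparing all coefficients of the braid equation on the subcoalgebra spanned by the three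
  intervals gives several dozen relations. The thirteen below imply the classification.\<close>

lemma braid_relations:
  shows "\<alpha>\<^sub>1 * \<beta>\<^sub>2 + \<beta>\<^sub>1
      = \<alpha>\<^sub>2 * \<beta>\<^sub>1 + \<beta>\<^sub>2"
    and "\<alpha>\<^sub>1 * \<beta>\<^sub>3 + \<beta>\<^sub>1
      = \<alpha>\<^sub>3 * \<beta>\<^sub>1 + \<beta>\<^sub>3"
    and "\<alpha>\<^sub>1 * \<beta>\<^sub>4 + \<beta>\<^sub>1
      = \<alpha>\<^sub>4 * \<beta>\<^sub>1 + \<beta>\<^sub>4"
    and "\<alpha>\<^sub>2 * \<beta>\<^sub>3 + \<beta>\<^sub>2
      = \<alpha>\<^sub>3 * \<beta>\<^sub>2 + \<beta>\<^sub>3"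
    and "\<alpha>\<^sub>4 * \<beta>\<^sub>2 + \<beta>\<^sub>4
      = \<alpha>\<^sub>2 * \<beta>\<^sub>4 + \<beta>\<^sub>2"
    and "\<alpha>\<^sub>4 * \<beta>\<^sub>3 + \<beta>\<^sub>4
      = \<alpha>\<^sub>3 * \<beta>\<^sub>4 + \<beta>\<^sub>3"
    and "\<alpha>\<^sub>1 * \<alpha>\<^sub>2 * \<beta>\<^sub>1 * \<beta>\<^sub>3 + \<alpha>\<^sub>1 * \<beta>\<^sub>1 * \<beta>\<^sub>2 + \<alpha>\<^sub>2 * \<Gamma>\<^sub>1
      = \<alpha>\<^sub>1 * \<alpha>\<^sub>2 * \<beta>\<^sub>2 * \<beta>\<^sub>4 + \<alpha>\<^sub>1 * \<Gamma>\<^sub>1 + \<alpha>\<^sub>2 * \<beta>\<^sub>1 * \<beta>\<^sub>2"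
    and "\<alpha>\<^sub>1 * \<alpha>\<^sub>1 * \<Gamma>\<^sub>1 + \<alpha>\<^sub>1 * \<beta>\<^sub>1 * \<beta>\<^sub>1 + \<alpha>\<^sub>1 * \<beta>\<^sub>1 * \<beta>\<^sub>2 + \<beta>\<^sub>1 * \<beta>\<^sub>1
      = \<alpha>\<^sub>1 * \<alpha>\<^sub>3 * \<beta>\<^sub>1 * \<beta>\<^sub>1 + \<alpha>\<^sub>1 * \<beta>\<^sub>1 * \<beta>\<^sub>3 + \<alpha>\<^sub>2 * \<beta>\<^sub>1 * \<beta>\<^sub>4 + \<Gamma>\<^sub>1"
    and "\<alpha>\<^sub>1 * \<alpha>\<^sub>3 * \<beta>\<^sub>2 * \<beta>\<^sub>2 + \<alpha>\<^sub>1 * \<beta>\<^sub>2 * \<beta>\<^sub>3 + \<alpha>\<^sub>2 * \<beta>\<^sub>2 * \<beta>\<^sub>4 + \<Gamma>\<^sub>1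
      = \<alpha>\<^sub>2 * \<alpha>\<^sub>2 * \<Gamma>\<^sub>1 + \<alpha>\<^sub>2 * \<beta>\<^sub>1 * \<beta>\<^sub>2 + \<alpha>\<^sub>2 * \<beta>\<^sub>2 * \<beta>\<^sub>2 + \<beta>\<^sub>2 * \<beta>\<^sub>2"
    and "\<alpha>\<^sub>1 * \<alpha>\<^sub>3 * \<beta>\<^sub>3 * \<beta>\<^sub>3 + \<alpha>\<^sub>1 * \<beta>\<^sub>3 * \<beta>\<^sub>3 + \<alpha>\<^sub>2 * \<beta>\<^sub>3 * \<beta>\<^sub>4 + \<Gamma>\<^sub>1
      = \<alpha>\<^sub>3 * \<alpha>\<^sub>3 * \<Gamma>\<^sub>1 + \<alpha>\<^sub>3 * \<beta>\<^sub>1 * \<beta>\<^sub>3 + \<alpha>\<^sub>3 * \<beta>\<^sub>2 * \<beta>\<^sub>3 + \<beta>\<^sub>3 * \<beta>\<^sub>3"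
    and "\<alpha>\<^sub>4 * \<alpha>\<^sub>4 * \<Gamma>\<^sub>1 + \<alpha>\<^sub>4 * \<beta>\<^sub>1 * \<beta>\<^sub>4 + \<alpha>\<^sub>4 * \<beta>\<^sub>2 * \<beta>\<^sub>4 + \<beta>\<^sub>4 * \<beta>\<^sub>4
      = \<alpha>\<^sub>1 * \<alpha>\<^sub>3 * \<beta>\<^sub>4 * \<beta>\<^sub>4 + \<alpha>\<^sub>1 * \<beta>\<^sub>3 * \<beta>\<^sub>4 + \<alpha>\<^sub>2 * \<beta>\<^sub>4 * \<beta>\<^sub>4 + \<Gamma>\<^sub>1"
    and "\<alpha>\<^sub>1 * \<alpha>\<^sub>3 * \<beta>\<^sub>3 * \<beta>\<^sub>4 + \<alpha>\<^sub>1 * \<beta>\<^sub>3 * \<beta>\<^sub>4 + \<alpha>\<^sub>3 * \<Gamma>\<^sub>1 + \<beta>\<^sub>1 * \<beta>\<^sub>3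
      = \<alpha>\<^sub>2 * \<alpha>\<^sub>4 * \<beta>\<^sub>3 * \<beta>\<^sub>4 + \<alpha>\<^sub>2 * \<beta>\<^sub>3 * \<beta>\<^sub>4 + \<alpha>\<^sub>4 * \<Gamma>\<^sub>1 + \<beta>\<^sub>2 * \<beta>\<^sub>4"
    and "\<alpha>\<^sub>1 * \<alpha>\<^sub>1 * \<alpha>\<^sub>3 * \<beta>\<^sub>3 * \<Gamma>\<^sub>1 + \<alpha>\<^sub>1 * \<alpha>\<^sub>1 * \<beta>\<^sub>3 * \<Gamma>\<^sub>1 + \<alpha>\<^sub>1 * \<alpha>\<^sub>2 * \<beta>\<^sub>1 * \<beta>\<^sub>3 * \<beta>\<^sub>4
        + \<alpha>\<^sub>1 * \<alpha>\<^sub>3 * \<beta>\<^sub>2 * \<Gamma>\<^sub>1 + \<alpha>\<^sub>1 * \<beta>\<^sub>1 * \<beta>\<^sub>2 * \<beta>\<^sub>3 + \<alpha>\<^sub>1 * \<beta>\<^sub>1 * \<Gamma>\<^sub>1 + \<alpha>\<^sub>2 * \<beta>\<^sub>4 * \<Gamma>\<^sub>1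
        + \<beta>\<^sub>1 * \<Gamma>\<^sub>1
      = \<alpha>\<^sub>1 * \<alpha>\<^sub>2 * \<alpha>\<^sub>3 * \<beta>\<^sub>4 * \<Gamma>\<^sub>1 + \<alpha>\<^sub>1 * \<alpha>\<^sub>2 * \<beta>\<^sub>2 * \<beta>\<^sub>3 * \<beta>\<^sub>4 + \<alpha>\<^sub>1 * \<alpha>\<^sub>3 * \<beta>\<^sub>1 * \<Gamma>\<^sub>1
        + \<alpha>\<^sub>1 * \<beta>\<^sub>3 * \<Gamma>\<^sub>1 + \<alpha>\<^sub>2 * \<alpha>\<^sub>2 * \<beta>\<^sub>4 * \<Gamma>\<^sub>1 + \<alpha>\<^sub>2 * \<beta>\<^sub>1 * \<beta>\<^sub>2 * \<beta>\<^sub>4 + \<alpha>\<^sub>2 * \<beta>\<^sub>2 * \<Gamma>\<^sub>1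
        + \<beta>\<^sub>2 * \<Gamma>\<^sub>1"
proof -
  let ?X = "ival x x" and ?U = "ival x y" and ?Y = "ival y y"
  let ?S = "{?X, ?U, ?Y}"
  have distinct: "?X \<noteq> ?U" "?X \<noteq> ?Y" "?U \<noteq> ?Y" "?U \<noteq> ?X" "?Y \<noteq> ?X" "?Y \<noteq> ?U"
    by (simp_all add: ival_eq_iff)
  \<comment> \<open>The braid equation restricts to the span of the nine pairs because
    \<open>r\<close> does not leave it. As (y,x) is not an interval, a pair outside the nine has an
    end point outside {x, y}.\<close>
  have closed: "Poly_Mapping.lookup (r (basis (p, q))) (s, t) = 0"
    if "p \<in> ?S" "q \<in> ?S" "(s, t) \<notin> ?S \<times> ?S" for p q s t
  proof -
    obtain e f g h where st: "s = ival e f" "t = ival g h" "e \<le> f" "g \<le> h"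
      by (metis ival_cases)
    have out: "\<not> {e, f, g, h} \<subseteq> {x, y}"
    proof
      assume "{e, f, g, h} \<subseteq> {x, y}"
      with st(3,4) have "(e, f) \<in> {(x, x), (x, y), (y, y)}" "(g, h) \<in> {(x, x), (x, y), (y, y)}"
        by auto
      with that(3) st(1,2) show False by auto
    qed
    have "coeff r a b c d e f g h = 0"
      if "(a, b) \<in> {(x, x), (x, y), (y, y)}" "(c, d) \<in> {(x, x), (x, y), (y, y)}" for a b c d
      using that coeff_xyxy_eq_0[OF st(3,4)] out
      by (elim insertE emptyE)
        (auto simp: coeff_points coeff_xxxy coeff_xyxx coeff_xyyy coeff_yyxy st(3,4))
    then show ?thesis
      using that(1,2) unfolding st(1,2) coeff_def by blast
  qed
  \<comment> \<open>In each instance below the output consists of the lower end points of the input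
    in reversed order, taken as point intervals. The input contains \<open>?U\<close> once in the
    first six relations, twice in the next six and three times in the last; this number is the
    degree of the relation in the \<beta> when \<open>\<Gamma>\<^sub>1\<close> has degree
    two.\<close>
  note braid_eq = braid_coefficients[where S = ?S, OF braid _ closed]
  note simps = distinct coeff_def[symmetric] coeff_tables xyxy_relations(1,3-9)
  show "\<alpha>\<^sub>1 * \<beta>\<^sub>2 + \<beta>\<^sub>1 = \<alpha>\<^sub>2 * \<beta>\<^sub>1 + \<beta>\<^sub>2"
    using braid_eq[where p = ?X and q = ?U and s = ?X and n = ?X and l = ?X and m = ?X]
    by (simp add: simps algebra_simps)
  show "\<alpha>\<^sub>1 * \<beta>\<^sub>3 + \<beta>\<^sub>1 = \<alpha>\<^sub>3 * \<beta>\<^sub>1 + \<beta>\<^sub>3"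
    using braid_eq[where p = ?X and q = ?U and s = ?Y and n = ?X and l = ?Y and m = ?X]
    by (simp add: simps algebra_simps)
  show "\<alpha>\<^sub>1 * \<beta>\<^sub>4 + \<beta>\<^sub>1 = \<alpha>\<^sub>4 * \<beta>\<^sub>1 + \<beta>\<^sub>4"
    using braid_eq[where p = ?X and q = ?Y and s = ?U and n = ?X and l = ?X and m = ?Y]
    by (simp add: simps algebra_simps)
  show "\<alpha>\<^sub>2 * \<beta>\<^sub>3 + \<beta>\<^sub>2 = \<alpha>\<^sub>3 * \<beta>\<^sub>2 + \<beta>\<^sub>3"
    using braid_eq[where p = ?U and q = ?X and s = ?Y and n = ?X and l = ?Y and m = ?X]
    by (simp add: simps algebra_simps)
  show "\<alpha>\<^sub>4 * \<beta>\<^sub>2 + \<beta>\<^sub>4 = \<alpha>\<^sub>2 * \<beta>\<^sub>4 + \<beta>\<^sub>2"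
    using braid_eq[where p = ?Y and q = ?U and s = ?X and n = ?Y and l = ?X and m = ?X]
    by (simp add: simps algebra_simps)
  show "\<alpha>\<^sub>4 * \<beta>\<^sub>3 + \<beta>\<^sub>4 = \<alpha>\<^sub>3 * \<beta>\<^sub>4 + \<beta>\<^sub>3"
    using braid_eq[where p = ?Y and q = ?U and s = ?Y and n = ?Y and l = ?Y and m = ?X]
    by (simp add: simps algebra_simps)
  show "\<alpha>\<^sub>1 * \<alpha>\<^sub>2 * \<beta>\<^sub>1 * \<beta>\<^sub>3 + \<alpha>\<^sub>1 * \<beta>\<^sub>1 * \<beta>\<^sub>2 + \<alpha>\<^sub>2 * \<Gamma>\<^sub>1 = \<alpha>\<^sub>1 * \<alpha>\<^sub>2 * \<beta>\<^sub>2 * \<beta>\<^sub>4 + \<alpha>\<^sub>1 * \<Gamma>\<^sub>1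
        + \<alpha>\<^sub>2 * \<beta>\<^sub>1 * \<beta>\<^sub>2"
    using braid_eq[where p = ?U and q = ?X and s = ?U and n = ?X and l = ?X and m = ?X]
    by (simp add: simps algebra_simps)
  show "\<alpha>\<^sub>1 * \<alpha>\<^sub>1 * \<Gamma>\<^sub>1 + \<alpha>\<^sub>1 * \<beta>\<^sub>1 * \<beta>\<^sub>1 + \<alpha>\<^sub>1 * \<beta>\<^sub>1 * \<beta>\<^sub>2 + \<beta>\<^sub>1 * \<beta>\<^sub>1 = \<alpha>\<^sub>1 * \<alpha>\<^sub>3 * \<beta>\<^sub>1 * \<beta>\<^sub>1
        + \<alpha>\<^sub>1 * \<beta>\<^sub>1 * \<beta>\<^sub>3 + \<alpha>\<^sub>2 * \<beta>\<^sub>1 * \<beta>\<^sub>4 + \<Gamma>\<^sub>1"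
    using braid_eq[where p = ?X and q = ?U and s = ?U and n = ?X and l = ?X and m = ?X]
    by (simp add: simps algebra_simps)
  show "\<alpha>\<^sub>1 * \<alpha>\<^sub>3 * \<beta>\<^sub>2 * \<beta>\<^sub>2 + \<alpha>\<^sub>1 * \<beta>\<^sub>2 * \<beta>\<^sub>3 + \<alpha>\<^sub>2 * \<beta>\<^sub>2 * \<beta>\<^sub>4 + \<Gamma>\<^sub>1 = \<alpha>\<^sub>2 * \<alpha>\<^sub>2 * \<Gamma>\<^sub>1
        + \<alpha>\<^sub>2 * \<beta>\<^sub>1 * \<beta>\<^sub>2 + \<alpha>\<^sub>2 * \<beta>\<^sub>2 * \<beta>\<^sub>2 + \<beta>\<^sub>2 * \<beta>\<^sub>2"
    using braid_eq[where p = ?U and q = ?U and s = ?X and n = ?X and l = ?X and m = ?X]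
    by (simp add: simps algebra_simps)
  show "\<alpha>\<^sub>1 * \<alpha>\<^sub>3 * \<beta>\<^sub>3 * \<beta>\<^sub>3 + \<alpha>\<^sub>1 * \<beta>\<^sub>3 * \<beta>\<^sub>3 + \<alpha>\<^sub>2 * \<beta>\<^sub>3 * \<beta>\<^sub>4 + \<Gamma>\<^sub>1 = \<alpha>\<^sub>3 * \<alpha>\<^sub>3 * \<Gamma>\<^sub>1
        + \<alpha>\<^sub>3 * \<beta>\<^sub>1 * \<beta>\<^sub>3 + \<alpha>\<^sub>3 * \<beta>\<^sub>2 * \<beta>\<^sub>3 + \<beta>\<^sub>3 * \<beta>\<^sub>3"
    using braid_eq[where p = ?U and q = ?U and s = ?Y and n = ?X and l = ?Y and m = ?X]
    by (simp add: simps algebra_simps)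
  show "\<alpha>\<^sub>4 * \<alpha>\<^sub>4 * \<Gamma>\<^sub>1 + \<alpha>\<^sub>4 * \<beta>\<^sub>1 * \<beta>\<^sub>4 + \<alpha>\<^sub>4 * \<beta>\<^sub>2 * \<beta>\<^sub>4 + \<beta>\<^sub>4 * \<beta>\<^sub>4 = \<alpha>\<^sub>1 * \<alpha>\<^sub>3 * \<beta>\<^sub>4 * \<beta>\<^sub>4
        + \<alpha>\<^sub>1 * \<beta>\<^sub>3 * \<beta>\<^sub>4 + \<alpha>\<^sub>2 * \<beta>\<^sub>4 * \<beta>\<^sub>4 + \<Gamma>\<^sub>1"
    using braid_eq[where p = ?Y and q = ?U and s = ?U and n = ?Y and l = ?X and m = ?X]
    by (simp add: simps algebra_simps)
  show "\<alpha>\<^sub>1 * \<alpha>\<^sub>3 * \<beta>\<^sub>3 * \<beta>\<^sub>4 + \<alpha>\<^sub>1 * \<beta>\<^sub>3 * \<beta>\<^sub>4 + \<alpha>\<^sub>3 * \<Gamma>\<^sub>1 + \<beta>\<^sub>1 * \<beta>\<^sub>3 = \<alpha>\<^sub>2 * \<alpha>\<^sub>4 * \<beta>\<^sub>3 * \<beta>\<^sub>4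
        + \<alpha>\<^sub>2 * \<beta>\<^sub>3 * \<beta>\<^sub>4 + \<alpha>\<^sub>4 * \<Gamma>\<^sub>1 + \<beta>\<^sub>2 * \<beta>\<^sub>4"
    using braid_eq[where p = ?U and q = ?Y and s = ?U and n = ?X and l = ?X and m = ?Y]
    by (simp add: simps algebra_simps)
  show "\<alpha>\<^sub>1 * \<alpha>\<^sub>1 * \<alpha>\<^sub>3 * \<beta>\<^sub>3 * \<Gamma>\<^sub>1 + \<alpha>\<^sub>1 * \<alpha>\<^sub>1 * \<beta>\<^sub>3 * \<Gamma>\<^sub>1 + \<alpha>\<^sub>1 * \<alpha>\<^sub>2 * \<beta>\<^sub>1 * \<beta>\<^sub>3 * \<beta>\<^sub>4
        + \<alpha>\<^sub>1 * \<alpha>\<^sub>3 * \<beta>\<^sub>2 * \<Gamma>\<^sub>1 + \<alpha>\<^sub>1 * \<beta>\<^sub>1 * \<beta>\<^sub>2 * \<beta>\<^sub>3 + \<alpha>\<^sub>1 * \<beta>\<^sub>1 * \<Gamma>\<^sub>1 + \<alpha>\<^sub>2 * \<beta>\<^sub>4 * \<Gamma>\<^sub>1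
        + \<beta>\<^sub>1 * \<Gamma>\<^sub>1 = \<alpha>\<^sub>1 * \<alpha>\<^sub>2 * \<alpha>\<^sub>3 * \<beta>\<^sub>4 * \<Gamma>\<^sub>1 + \<alpha>\<^sub>1 * \<alpha>\<^sub>2 * \<beta>\<^sub>2 * \<beta>\<^sub>3 * \<beta>\<^sub>4
        + \<alpha>\<^sub>1 * \<alpha>\<^sub>3 * \<beta>\<^sub>1 * \<Gamma>\<^sub>1 + \<alpha>\<^sub>1 * \<beta>\<^sub>3 * \<Gamma>\<^sub>1 + \<alpha>\<^sub>2 * \<alpha>\<^sub>2 * \<beta>\<^sub>4 * \<Gamma>\<^sub>1 + \<alpha>\<^sub>2 * \<beta>\<^sub>1 * \<beta>\<^sub>2 * \<beta>\<^sub>4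
        + \<alpha>\<^sub>2 * \<beta>\<^sub>2 * \<Gamma>\<^sub>1 + \<beta>\<^sub>2 * \<Gamma>\<^sub>1"
    using braid_eq[where p = ?U and q = ?U and s = ?U and n = ?X and l = ?X and m = ?X]
    by (simp add: simps algebra_simps)
qed

end

section \<open>Solving the relations\<close>

context flip_square
begin

text \<open>Without the \<beta>, four of the quadratic relations are \<open>\<Gamma>\<^sub>1\<close>
  times a polynomial in the \<alpha>, and \<open>\<Gamma>\<^sub>1\<close> can be cancelled.\<close>

lemma alpha_signs:
  assumes "\<beta>\<^sub>1 = 0" "\<beta>\<^sub>2 = 0" "\<beta>\<^sub>3 = 0" "\<beta>\<^sub>4 = 0" "\<Gamma>\<^sub>1 \<noteq> 0"
  shows "\<alpha>\<^sub>1 \<in> {1, - 1}" "\<alpha>\<^sub>3 \<in> {1, - 1}" "\<alpha>\<^sub>2 = \<alpha>\<^sub>1" "\<alpha>\<^sub>4 = \<alpha>\<^sub>3"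
proof -
  have "(\<alpha>\<^sub>1 - 1) * (\<alpha>\<^sub>1 + 1) = 0" "(\<alpha>\<^sub>3 - 1) * (\<alpha>\<^sub>3 + 1) = 0"
    using braid_relations(8,10) assms by (simp_all add: algebra_simps)
  then show "\<alpha>\<^sub>1 \<in> {1, - 1}" "\<alpha>\<^sub>3 \<in> {1, - 1}"
    by (auto simp: eq_neg_iff_add_eq_0)
  show "\<alpha>\<^sub>2 = \<alpha>\<^sub>1" "\<alpha>\<^sub>4 = \<alpha>\<^sub>3"
    using braid_relations(7,12) assms by simp_all
qed

text \<open>The first six braid relations are the vanishing 2 by 2 minors of the matrix with rows
  \<open>\<alpha>\<^sub>i - 1\<close> and \<open>\<beta>\<^sub>i\<close>, one for each pair of
  indices. Any nonzero \<beta> yields the quotient \<open>C\<close>.\<close>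

lemma ex_proportionality_factor:
  assumes "\<beta>\<^sub>1 \<noteq> 0 \<or> \<beta>\<^sub>2 \<noteq> 0 \<or> \<beta>\<^sub>3 \<noteq> 0 \<or> \<beta>\<^sub>4 \<noteq> 0"
  obtains C where "\<alpha>\<^sub>1 = 1 + C * \<beta>\<^sub>1" "\<alpha>\<^sub>2 = 1 + C * \<beta>\<^sub>2" "\<alpha>\<^sub>3 = 1 + C * \<beta>\<^sub>3" "\<alpha>\<^sub>4 = 1 + C * \<beta>\<^sub>4"
proof -
  have "\<exists>C. \<alpha>\<^sub>1 = 1 + C * \<beta>\<^sub>1 \<and> \<alpha>\<^sub>2 = 1 + C * \<beta>\<^sub>2 \<and> \<alpha>\<^sub>3 = 1 + C * \<beta>\<^sub>3 \<and> \<alpha>\<^sub>4 = 1 + C * \<beta>\<^sub>4"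
    using assms
  proof (elim disjE)
    assume "\<beta>\<^sub>1 \<noteq> 0"
    then show ?thesis using braid_relations(1-6)
      by (intro exI[of _ "(\<alpha>\<^sub>1 - 1) / \<beta>\<^sub>1"]) (simp add: field_simps)
  next
    assume "\<beta>\<^sub>2 \<noteq> 0"
    then show ?thesis using braid_relations(1-6)
      by (intro exI[of _ "(\<alpha>\<^sub>2 - 1) / \<beta>\<^sub>2"]) (simp add: field_simps)
  next
    assume "\<beta>\<^sub>3 \<noteq> 0"
    then show ?thesis using braid_relations(1-6)
      by (intro exI[of _ "(\<alpha>\<^sub>3 - 1) / \<beta>\<^sub>3"]) (simp add: field_simps)
  next
    assume "\<beta>\<^sub>4 \<noteq> 0"
    then show ?thesis using braid_relations(1-6)
      by (intro exI[of _ "(\<alpha>\<^sub>4 - 1) / \<beta>\<^sub>4"]) (simp add: field_simps)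
  qed
  then show ?thesis using that by blast
qed

text \<open>This is the case C = 0. Four quadratic relations become a single \<beta> times
  \<open>\<beta>\<^sub>1 + \<beta>\<^sub>2 - \<beta>\<^sub>3 - \<beta>\<^sub>4\<close>, so this sum
  vanishes; a fifth one then factors into the two alternatives.\<close>

lemma unipotent_cases:
  assumes "\<beta>\<^sub>1 \<noteq> 0 \<or> \<beta>\<^sub>2 \<noteq> 0 \<or> \<beta>\<^sub>3 \<noteq> 0 \<or> \<beta>\<^sub>4 \<noteq> 0"
    and alpha: "\<alpha>\<^sub>1 = 1" "\<alpha>\<^sub>2 = 1" "\<alpha>\<^sub>3 = 1" "\<alpha>\<^sub>4 = 1"
  shows "\<beta>\<^sub>3 = \<beta>\<^sub>2 \<and> \<beta>\<^sub>4 = \<beta>\<^sub>1 \<or> \<beta>\<^sub>3 + \<beta>\<^sub>4 = 0 \<and> \<beta>\<^sub>1 + \<beta>\<^sub>2 = 0 \<and> \<beta>\<^sub>3 \<noteq> - \<beta>\<^sub>1"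
proof -
  have *: "\<beta>\<^sub>i * (\<beta>\<^sub>1 + \<beta>\<^sub>2 - \<beta>\<^sub>3 - \<beta>\<^sub>4) = 0" if "\<beta>\<^sub>i \<in> {\<beta>\<^sub>1, \<beta>\<^sub>2, \<beta>\<^sub>3, \<beta>\<^sub>4}" for \<beta>\<^sub>i
    using that braid_relations(8-11) by (elim insertE emptyE) (simp_all add: alpha algebra_simps)
  have "\<beta>\<^sub>1 + \<beta>\<^sub>2 - \<beta>\<^sub>3 - \<beta>\<^sub>4 = 0"
    using *[of \<beta>\<^sub>1] *[of \<beta>\<^sub>2] *[of \<beta>\<^sub>3] *[of \<beta>\<^sub>4] assms(1) by auto
  then have sum: "\<beta>\<^sub>4 = \<beta>\<^sub>1 + \<beta>\<^sub>2 - \<beta>\<^sub>3"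
    by (simp add: algebra_simps)
  have "(\<beta>\<^sub>1 + \<beta>\<^sub>2) * (\<beta>\<^sub>3 - \<beta>\<^sub>2) = 0"
    using braid_relations(7) by (simp add: alpha sum algebra_simps)
  then consider "\<beta>\<^sub>1 + \<beta>\<^sub>2 = 0" | "\<beta>\<^sub>3 = \<beta>\<^sub>2"
    by auto
  then show ?thesis
  proof cases
    \<comment> \<open>If moreover \<open>\<beta>\<^sub>3 = - \<beta>\<^sub>1\<close>, then
      \<open>\<beta>\<^sub>3 = \<beta>\<^sub>2\<close> and
      \<open>\<beta>\<^sub>4 = \<beta>\<^sub>1\<close>, so the overlap falls under the first
      alternative.\<close>
    case 1
    then have "\<beta>\<^sub>2 = - \<beta>\<^sub>1" by (simp add: eq_neg_iff_add_eq_0 add.commute)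
    then show ?thesis using sum by auto
  qed (use sum in simp)
qed

text \<open>The cubic relation has the nonzero factor
  \<open>\<beta>\<^sub>1 + \<beta>\<^sub>3\<close>, but what remains is twice
  \<open>\<Gamma>\<^sub>1 - \<beta>\<^sub>1 * \<beta>\<^sub>3\<close>, which equals
  \<open>\<Gamma>\<^sub>1 - \<Gamma>\<^sub>4\<close>. The value of \<Gamma> itself therefore
  requires division by 2.\<close>

lemma unipotent_Gamma:
  assumes alpha: "\<alpha>\<^sub>1 = 1" "\<alpha>\<^sub>2 = 1" "\<alpha>\<^sub>3 = 1" "\<alpha>\<^sub>4 = 1"
    and sum: "\<beta>\<^sub>3 + \<beta>\<^sub>4 = 0" "\<beta>\<^sub>1 + \<beta>\<^sub>2 = 0" "\<beta>\<^sub>3 \<noteq> - \<beta>\<^sub>1"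
  shows "\<Gamma>\<^sub>1 = \<Gamma>\<^sub>4" "(2 :: 'k) \<noteq> 0 \<Longrightarrow> \<Gamma>\<^sub>4 = \<beta>\<^sub>1 * \<beta>\<^sub>3"
proof -
  have ne: "\<beta>\<^sub>1 + \<beta>\<^sub>3 \<noteq> 0" using sum(3) by (auto simp: eq_neg_iff_add_eq_0 add.commute)
  have neg: "\<beta>\<^sub>2 = - \<beta>\<^sub>1" "\<beta>\<^sub>4 = - \<beta>\<^sub>3"
    using sum(1,2) by (simp_all add: eq_neg_iff_add_eq_0 add.commute)
  have "(\<beta>\<^sub>1 + \<beta>\<^sub>3) * (2 * (\<Gamma>\<^sub>1 - \<beta>\<^sub>1 * \<beta>\<^sub>3)) = 0"
    using braid_relations(13) by (simp add: alpha neg algebra_simps)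
  with ne have g: "2 * (\<Gamma>\<^sub>1 - \<beta>\<^sub>1 * \<beta>\<^sub>3) = 0" by simp
  have "\<Gamma>\<^sub>1 - \<Gamma>\<^sub>4 = 2 * (\<Gamma>\<^sub>1 - \<beta>\<^sub>1 * \<beta>\<^sub>3)"
    by (simp add: xyxy_relations(9) neg mult_2 algebra_simps)
  also note g
  finally show *: "\<Gamma>\<^sub>1 = \<Gamma>\<^sub>4" by simp
  show "\<Gamma>\<^sub>4 = \<beta>\<^sub>1 * \<beta>\<^sub>3" if "(2 :: 'k) \<noteq> 0"
    using g that * by simp
qed

context
  fixes C :: 'k
  assumes alpha_C: "\<alpha>\<^sub>1 = 1 + C * \<beta>\<^sub>1" "\<alpha>\<^sub>2 = 1 + C * \<beta>\<^sub>2" "\<alpha>\<^sub>3 = 1 + C * \<beta>\<^sub>3" "\<alpha>\<^sub>4 = 1 + C * \<beta>\<^sub>4"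
    and C: "C \<noteq> 0"
begin

text \<open>This is the side condition \<open>\<alpha>\<^sub>1 * \<alpha>\<^sub>3 = \<alpha>\<^sub>2
  * \<alpha>\<^sub>4\<close> after substituting \<open>1 + C * \<beta>\<^sub>i\<close>, cancelling
  the constant 1 and dividing by \<open>C\<close>.\<close>

lemma beta_relation: "\<alpha>\<^sub>2 * \<beta>\<^sub>4 = \<beta>\<^sub>1 - \<beta>\<^sub>2 + \<alpha>\<^sub>1 * \<beta>\<^sub>3"
proof -
  have "C * (\<alpha>\<^sub>2 * \<beta>\<^sub>4) = C * (\<beta>\<^sub>1 - \<beta>\<^sub>2 + \<alpha>\<^sub>1 * \<beta>\<^sub>3)"
    using xyxy_relations(2) by (simp add: alpha_C algebra_simps)
  with C show ?thesis by simp
qed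

text \<open>The product is the difference of the two sides of the eighth braid relation, corrected
  by \<open>\<beta>\<^sub>1\<close> times \<open>beta_relation\<close>.\<close>

lemma beta1_factors: "\<beta>\<^sub>1 * (\<alpha>\<^sub>1 + 1) * (\<beta>\<^sub>3 * \<alpha>\<^sub>1 - \<beta>\<^sub>2 - \<Gamma>\<^sub>1 * C) = 0"
proof -
  have "\<beta>\<^sub>1 * (\<alpha>\<^sub>1 + 1) * (\<beta>\<^sub>3 * \<alpha>\<^sub>1 - \<beta>\<^sub>2 - \<Gamma>\<^sub>1 * C)
    = (\<alpha>\<^sub>1 * \<alpha>\<^sub>3 * \<beta>\<^sub>1 * \<beta>\<^sub>1 + \<alpha>\<^sub>1 * \<beta>\<^sub>1 * \<beta>\<^sub>3 + \<alpha>\<^sub>2 * \<beta>\<^sub>1 * \<beta>\<^sub>4 + \<Gamma>\<^sub>1)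
      - (\<alpha>\<^sub>1 * \<alpha>\<^sub>1 * \<Gamma>\<^sub>1 + \<alpha>\<^sub>1 * \<beta>\<^sub>1 * \<beta>\<^sub>1 + \<alpha>\<^sub>1 * \<beta>\<^sub>1 * \<beta>\<^sub>2 + \<beta>\<^sub>1 * \<beta>\<^sub>1)
      - \<beta>\<^sub>1 * (\<alpha>\<^sub>2 * \<beta>\<^sub>4 - (\<beta>\<^sub>1 - \<beta>\<^sub>2 + \<alpha>\<^sub>1 * \<beta>\<^sub>3))"
    by (simp add: alpha_C algebra_simps)
  then show ?thesis
    by (simp only: braid_relations(8) beta_relation diff_self mult_zero_right)
qed

lemma beta1_zero:
  assumes "\<beta>\<^sub>1 = 0"
  shows "\<beta>\<^sub>2 = 0 \<or> C * \<Gamma>\<^sub>1 = \<alpha>\<^sub>2 * \<beta>\<^sub>4"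
proof -
  have "\<beta>\<^sub>2 * (C * \<Gamma>\<^sub>1 - \<alpha>\<^sub>2 * \<beta>\<^sub>4) = 0"
    using braid_relations(7) by (simp add: alpha_C assms algebra_simps)
  then show ?thesis by auto
qed

text \<open>Here \<open>\<alpha>\<^sub>1 = \<alpha>\<^sub>2 = 1\<close>, so
  \<open>beta_relation\<close> reduces to \<open>\<beta>\<^sub>3 = \<beta>\<^sub>4\<close>. The
  tenth braid relation then factors, and the hypotheses exclude every factor but
  \<open>\<alpha>\<^sub>4 + 1\<close>.\<close>

lemma beta12_zero:
  assumes "\<beta>\<^sub>1 = 0" "\<beta>\<^sub>2 = 0" "\<beta>\<^sub>4 \<noteq> 0" "C * \<Gamma>\<^sub>1 \<noteq> \<beta>\<^sub>4"
  shows "\<beta>\<^sub>3 = \<beta>\<^sub>4" "\<alpha>\<^sub>4 = - 1"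
proof -
  show 34: "\<beta>\<^sub>3 = \<beta>\<^sub>4" using beta_relation alpha_C assms by simp
  have "(\<alpha>\<^sub>4 + 1) * \<beta>\<^sub>4 * (\<beta>\<^sub>4 - C * \<Gamma>\<^sub>1) = 0"
    using braid_relations(10) by (simp add: alpha_C 34 assms(1,2) algebra_simps)
  then show "\<alpha>\<^sub>4 = - 1" using assms(3,4) by (auto simp: eq_neg_iff_add_eq_0)
qed

text \<open>Multiplying the seventh braid relation by \<open>C ^ 2\<close> makes each \<beta> occur
  as \<open>C * \<beta>\<^sub>i\<close>, which is \<open>\<alpha>\<^sub>i - 1\<close>. With
  \<open>\<alpha>\<^sub>3 = - (\<alpha>\<^sub>2 * \<alpha>\<^sub>4)\<close> the factor
  \<open>\<alpha>\<^sub>2 + 1\<close> splits off.\<close>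

lemma alpha1_minus_one:
  assumes "\<alpha>\<^sub>1 + 1 = 0"
  shows "\<alpha>\<^sub>2 = - 1 \<or> \<alpha>\<^sub>2 * \<beta>\<^sub>4 * C - C ^ 2 * \<Gamma>\<^sub>1 = - 2"
proof -
  have 1: "\<alpha>\<^sub>1 = - 1" using assms by (simp add: eq_neg_iff_add_eq_0)
  have c: "C * \<beta>\<^sub>1 = - 2" "C * \<beta>\<^sub>2 = \<alpha>\<^sub>2 - 1" "C * \<beta>\<^sub>3 = \<alpha>\<^sub>3 - 1" "C * \<beta>\<^sub>4 = \<alpha>\<^sub>4 - 1"
    using alpha_C 1 by (simp_all add: algebra_simps eq_neg_iff_add_eq_0)
  have 3: "\<alpha>\<^sub>3 = - (\<alpha>\<^sub>2 * \<alpha>\<^sub>4)"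
    using xyxy_relations(2) 1 by (metis mult_minus1 minus_minus)
  have "(\<alpha>\<^sub>2 + 1) * \<Gamma>\<^sub>1 - \<beta>\<^sub>1 * \<beta>\<^sub>2 * (\<alpha>\<^sub>2 + 1) - \<alpha>\<^sub>2 * (\<beta>\<^sub>1 * \<beta>\<^sub>3 - \<beta>\<^sub>2 * \<beta>\<^sub>4) = 0"
    using braid_relations(7) by (simp add: 1 algebra_simps)
  then have "C ^ 2 * ((\<alpha>\<^sub>2 + 1) * \<Gamma>\<^sub>1 - \<beta>\<^sub>1 * \<beta>\<^sub>2 * (\<alpha>\<^sub>2 + 1) - \<alpha>\<^sub>2 * (\<beta>\<^sub>1 * \<beta>\<^sub>3 - \<beta>\<^sub>2 * \<beta>\<^sub>4)) = 0"
    by simp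
  also have "C ^ 2 * ((\<alpha>\<^sub>2 + 1) * \<Gamma>\<^sub>1 - \<beta>\<^sub>1 * \<beta>\<^sub>2 * (\<alpha>\<^sub>2 + 1) - \<alpha>\<^sub>2 * (\<beta>\<^sub>1 * \<beta>\<^sub>3 - \<beta>\<^sub>2 * \<beta>\<^sub>4))
      = (\<alpha>\<^sub>2 + 1) * (C ^ 2 * \<Gamma>\<^sub>1) - (C * \<beta>\<^sub>1) * (C * \<beta>\<^sub>2) * (\<alpha>\<^sub>2 + 1)
        - \<alpha>\<^sub>2 * ((C * \<beta>\<^sub>1) * (C * \<beta>\<^sub>3) - (C * \<beta>\<^sub>2) * (C * \<beta>\<^sub>4))"
    by (simp add: power2_eq_square algebra_simps)
  also have "\<dots> = (\<alpha>\<^sub>2 + 1) * (C ^ 2 * \<Gamma>\<^sub>1 - 2 - \<alpha>\<^sub>2 * (C * \<beta>\<^sub>4))"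
    unfolding c 3 by (simp add: algebra_simps)
  finally have "\<alpha>\<^sub>2 + 1 = 0 \<or> C ^ 2 * \<Gamma>\<^sub>1 - 2 - \<alpha>\<^sub>2 * (C * \<beta>\<^sub>4) = 0"
    by (simp only: mult_eq_0_iff)
  then show ?thesis
    by (auto simp: eq_neg_iff_add_eq_0 algebra_simps)
qed

end

end

theorem theorem5p4:
  fixes r :: "('a::order, 'k::field) dd \<Rightarrow> ('a, 'k) dd"
    and x y :: 'a
    and \<alpha>\<^sub>1 \<alpha>\<^sub>2 \<alpha>\<^sub>3 \<alpha>\<^sub>4 \<beta>\<^sub>1 \<beta>\<^sub>2 \<beta>\<^sub>3 \<beta>\<^sub>4 A B\<^sub>1 B\<^sub>2 B\<^sub>3 B\<^sub>4 \<Gamma>\<^sub>1 \<Gamma>\<^sub>2 \<Gamma>\<^sub>3 \<Gamma>\<^sub>4 :: 'k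
    and M T :: "'k mat"
  assumes locally_finite: "\<And>a b :: 'a. finite {a..b}"
    and braided: "non_degenerate_braided_set r"
    and cover: "covers x y"
    and xx: "induced r (x, x) (x, x)" and xy: "induced r (x, y) (y, x)"
    and yx: "induced r (y, x) (x, y)" and yy: "induced r (y, y) (y, y)"
    and M: "M = coeff_matrix r x y"
    and "\<alpha>\<^sub>1 = coeff r x x x y x y x x" and "\<alpha>\<^sub>2 = coeff r x y x x x x x y"
    and "\<alpha>\<^sub>3 = coeff r x y y y y y x y" and "\<alpha>\<^sub>4 = coeff r y y x y x y y y"
    and "\<beta>\<^sub>1 = coeff r x x x y x x x x" and "\<beta>\<^sub>2 = coeff r x y x x x x x x"
    and "\<beta>\<^sub>3 = coeff r x y y y y y x x" and "\<beta>\<^sub>4 = coeff r y y x y x x y y"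
    and "A = coeff r x y x y x y x y"
    and "B\<^sub>1 = coeff r x y x y x x x y" and "B\<^sub>2 = coeff r x y x y x y x x"
    and "B\<^sub>3 = coeff r x y x y x y y y" and "B\<^sub>4 = coeff r x y x y y y x y"
    and "\<Gamma>\<^sub>1 = coeff r x y x y x x x x" and "\<Gamma>\<^sub>2 = coeff r x y x y x x y y"
    and "\<Gamma>\<^sub>3 = coeff r x y x y y y x x" and "\<Gamma>\<^sub>4 = coeff r x y x y y y y y"
    and T: "T = mat_of_rows_list 9
    [[1,  \<beta>\<^sub>1, 0,  \<beta>\<^sub>2, \<Gamma>\<^sub>1,   0, 0,   0, 0],
     [0,   0, 0,  \<alpha>\<^sub>2, B\<^sub>1,   0, 0,   0, 0],
     [0,   0, 0, -\<beta>\<^sub>2, \<Gamma>\<^sub>2,   0, 1,  \<beta>\<^sub>4, 0],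
     [0,  \<alpha>\<^sub>1, 0,   0, B\<^sub>2,   0, 0,   0, 0],
     [0,   0, 0,   0,  A,   0, 0,   0, 0],
     [0,   0, 0,   0, B\<^sub>3,   0, 0,  \<alpha>\<^sub>4, 0],
     [0, -\<beta>\<^sub>1, 1,   0, \<Gamma>\<^sub>3,  \<beta>\<^sub>3, 0,   0, 0],
     [0,   0, 0,   0, B\<^sub>4,  \<alpha>\<^sub>3, 0,   0, 0],
     [0,   0, 0,   0, \<Gamma>\<^sub>4, -\<beta>\<^sub>3, 0, -\<beta>\<^sub>4, 1]]"
  shows
    "\<comment> \<open>1)\<close>
     (\<beta>\<^sub>1 = 0 \<and> \<beta>\<^sub>2 = 0 \<and> \<beta>\<^sub>3 = 0 \<and> \<beta>\<^sub>4 = 0 \<and> \<Gamma>\<^sub>1 = 0 \<longrightarrow>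
       M = T \<and> \<alpha>\<^sub>1 \<noteq> 0 \<and> \<alpha>\<^sub>2 \<noteq> 0 \<and> \<alpha>\<^sub>3 \<noteq> 0 \<and>
       \<alpha>\<^sub>4 = \<alpha>\<^sub>1 * \<alpha>\<^sub>3 / \<alpha>\<^sub>2 \<and> A = \<alpha>\<^sub>1 * \<alpha>\<^sub>3 \<and>
       \<beta>\<^sub>1 = 0 \<and> \<beta>\<^sub>2 = 0 \<and> \<beta>\<^sub>3 = 0 \<and> \<beta>\<^sub>4 = 0 \<and>
       B\<^sub>1 = 0 \<and> B\<^sub>2 = 0 \<and> B\<^sub>3 = 0 \<and> B\<^sub>4 = 0 \<and>
       \<Gamma>\<^sub>1 = 0 \<and> \<Gamma>\<^sub>2 = 0 \<and> \<Gamma>\<^sub>3 = 0 \<and> \<Gamma>\<^sub>4 = 0) \<and>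
     \<comment> \<open>2)\<close>
     (\<beta>\<^sub>1 = 0 \<and> \<beta>\<^sub>2 = 0 \<and> \<beta>\<^sub>3 = 0 \<and> \<beta>\<^sub>4 = 0 \<and> \<Gamma>\<^sub>1 \<noteq> 0 \<longrightarrow>
       M = T \<and> \<alpha>\<^sub>1 \<in> {1, -1} \<and> \<alpha>\<^sub>3 \<in> {1, -1} \<and> \<Gamma>\<^sub>1 \<noteq> 0 \<and>
       \<alpha>\<^sub>2 = \<alpha>\<^sub>1 \<and> \<alpha>\<^sub>4 = \<alpha>\<^sub>3 \<and> A = \<alpha>\<^sub>1 * \<alpha>\<^sub>3 \<and>
       \<beta>\<^sub>1 = 0 \<and> \<beta>\<^sub>2 = 0 \<and> \<beta>\<^sub>3 = 0 \<and> \<beta>\<^sub>4 = 0 \<and>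
       B\<^sub>1 = 0 \<and> B\<^sub>2 = 0 \<and> B\<^sub>3 = 0 \<and> B\<^sub>4 = 0 \<and>
       \<Gamma>\<^sub>2 = 0 \<and> \<Gamma>\<^sub>3 = 0 \<and> \<Gamma>\<^sub>4 = - \<Gamma>\<^sub>1) \<and>
     (\<beta>\<^sub>1 \<noteq> 0 \<or> \<beta>\<^sub>2 \<noteq> 0 \<or> \<beta>\<^sub>3 \<noteq> 0 \<or> \<beta>\<^sub>4 \<noteq> 0 \<longrightarrow>
       (\<exists>C. \<alpha>\<^sub>1 - 1 = C * \<beta>\<^sub>1 \<and> \<alpha>\<^sub>2 - 1 = C * \<beta>\<^sub>2 \<and> \<alpha>\<^sub>3 - 1 = C * \<beta>\<^sub>3 \<and> \<alpha>\<^sub>4 - 1 = C * \<beta>\<^sub>4 \<and>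
        \<comment> \<open>3)\<close>
        (C = 0 \<longrightarrow>
           ((\<beta>\<^sub>3 = \<beta>\<^sub>2 \<and> \<beta>\<^sub>4 = \<beta>\<^sub>1) \<or> (\<beta>\<^sub>3 + \<beta>\<^sub>4 = 0 \<and> \<beta>\<^sub>1 + \<beta>\<^sub>2 = 0 \<and> \<beta>\<^sub>3 \<noteq> - \<beta>\<^sub>1)) \<and>
           (\<beta>\<^sub>3 = \<beta>\<^sub>2 \<and> \<beta>\<^sub>4 = \<beta>\<^sub>1 \<longrightarrow>
              M = T \<and> (\<beta>\<^sub>1, \<beta>\<^sub>2) \<noteq> (0, 0) \<and>
              \<alpha>\<^sub>1 = 1 \<and> \<alpha>\<^sub>2 = 1 \<and> \<alpha>\<^sub>3 = 1 \<and> \<alpha>\<^sub>4 = 1 \<and> A = 1 \<and>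
              \<beta>\<^sub>3 = \<beta>\<^sub>2 \<and> \<beta>\<^sub>4 = \<beta>\<^sub>1 \<and>
              B\<^sub>1 = \<beta>\<^sub>1 \<and> B\<^sub>2 = \<beta>\<^sub>2 \<and> B\<^sub>3 = - \<beta>\<^sub>2 \<and> B\<^sub>4 = - \<beta>\<^sub>1 \<and>
              \<Gamma>\<^sub>2 = - \<beta>\<^sub>1 * \<beta>\<^sub>2 \<and> \<Gamma>\<^sub>3 = - \<beta>\<^sub>1 * \<beta>\<^sub>2 \<and> \<Gamma>\<^sub>4 = 2 * \<beta>\<^sub>1 * \<beta>\<^sub>2 - \<Gamma>\<^sub>1) \<and>
           (\<beta>\<^sub>3 + \<beta>\<^sub>4 = 0 \<and> \<beta>\<^sub>1 + \<beta>\<^sub>2 = 0 \<and> \<beta>\<^sub>3 \<noteq> - \<beta>\<^sub>1 \<longrightarrow>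
              M = T \<and> \<beta>\<^sub>1 + \<beta>\<^sub>3 \<noteq> 0 \<and>
              \<alpha>\<^sub>1 = 1 \<and> \<alpha>\<^sub>2 = 1 \<and> \<alpha>\<^sub>3 = 1 \<and> \<alpha>\<^sub>4 = 1 \<and> A = 1 \<and>
              \<beta>\<^sub>2 = - \<beta>\<^sub>1 \<and> \<beta>\<^sub>4 = - \<beta>\<^sub>3 \<and>
              B\<^sub>1 = - \<beta>\<^sub>3 \<and> B\<^sub>2 = \<beta>\<^sub>3 \<and> B\<^sub>3 = \<beta>\<^sub>1 \<and> B\<^sub>4 = - \<beta>\<^sub>1 \<and>
              \<Gamma>\<^sub>1 = \<Gamma>\<^sub>4 \<and> ((2 :: 'k) \<noteq> 0 \<longrightarrow> \<Gamma>\<^sub>4 = \<beta>\<^sub>1 * \<beta>\<^sub>3) \<and>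
              \<Gamma>\<^sub>2 = - \<beta>\<^sub>1 * \<beta>\<^sub>3 \<and> \<Gamma>\<^sub>3 = - \<beta>\<^sub>1 * \<beta>\<^sub>3)) \<and>
        \<comment> \<open>4)\<close>
        (C \<noteq> 0 \<longrightarrow>
           \<beta>\<^sub>1 * (\<alpha>\<^sub>1 + 1) * (\<beta>\<^sub>3 * \<alpha>\<^sub>1 - \<beta>\<^sub>2 - \<Gamma>\<^sub>1 * C) = 0 \<and>
           \<comment> \<open>4a)\<close>
           (\<beta>\<^sub>1 = 0 \<longrightarrow>
              (\<Gamma>\<^sub>1 = \<alpha>\<^sub>2 * \<beta>\<^sub>4 / C \<or> (\<beta>\<^sub>2 = 0 \<and> \<Gamma>\<^sub>1 \<noteq> \<beta>\<^sub>4 / C)) \<and>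
              (\<Gamma>\<^sub>1 = \<alpha>\<^sub>2 * \<beta>\<^sub>4 / C \<longrightarrow>
                 M = T \<and> C \<noteq> 0 \<and> (\<beta>\<^sub>2, \<beta>\<^sub>4) \<noteq> (0, 0) \<and>
                 C * \<beta>\<^sub>1 \<noteq> - 1 \<and> C * \<beta>\<^sub>2 \<noteq> - 1 \<and> C * \<beta>\<^sub>3 \<noteq> - 1 \<and> C * \<beta>\<^sub>4 \<noteq> - 1 \<and>
                 \<beta>\<^sub>1 = 0 \<and> \<alpha>\<^sub>1 = 1 \<and>
                 \<alpha>\<^sub>1 = 1 + C * \<beta>\<^sub>1 \<and> \<alpha>\<^sub>2 = 1 + C * \<beta>\<^sub>2 \<and> \<alpha>\<^sub>3 = 1 + C * \<beta>\<^sub>3 \<and> \<alpha>\<^sub>4 = 1 + C * \<beta>\<^sub>4 \<and>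
                 \<beta>\<^sub>3 = \<beta>\<^sub>2 + \<alpha>\<^sub>2 * \<beta>\<^sub>4 \<and> A = \<alpha>\<^sub>2 * \<alpha>\<^sub>4 \<and>
                 B\<^sub>1 = \<alpha>\<^sub>2 * \<beta>\<^sub>4 \<and> B\<^sub>2 = \<beta>\<^sub>3 \<and> B\<^sub>3 = - \<alpha>\<^sub>4 * \<beta>\<^sub>2 \<and> B\<^sub>4 = 0 \<and>
                 \<Gamma>\<^sub>1 = \<alpha>\<^sub>2 * \<beta>\<^sub>4 / C \<and> \<Gamma>\<^sub>2 = - \<beta>\<^sub>2 * \<beta>\<^sub>4 \<and> \<Gamma>\<^sub>3 = 0 \<and>
                 \<Gamma>\<^sub>4 = \<beta>\<^sub>2 * \<beta>\<^sub>4 - \<alpha>\<^sub>2 * \<beta>\<^sub>4 / C) \<and>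
              (\<beta>\<^sub>2 = 0 \<and> \<Gamma>\<^sub>1 \<noteq> \<beta>\<^sub>4 / C \<longrightarrow>
                 M = T \<and> \<Gamma>\<^sub>1 \<noteq> - (\<beta>\<^sub>4 ^ 2 / 2) \<and> \<beta>\<^sub>4 \<noteq> 0 \<and>
                 \<alpha>\<^sub>1 = 1 \<and> \<alpha>\<^sub>2 = 1 \<and> \<alpha>\<^sub>3 = - 1 \<and> \<alpha>\<^sub>4 = - 1 \<and>
                 \<beta>\<^sub>1 = 0 \<and> \<beta>\<^sub>2 = 0 \<and> \<beta>\<^sub>3 = \<beta>\<^sub>4 \<and> A = - 1 \<and>
                 B\<^sub>1 = \<beta>\<^sub>4 \<and> B\<^sub>2 = \<beta>\<^sub>4 \<and> B\<^sub>3 = 0 \<and> B\<^sub>4 = 0 \<and>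
                 \<Gamma>\<^sub>2 = 0 \<and> \<Gamma>\<^sub>3 = 0 \<and> \<Gamma>\<^sub>4 = - \<Gamma>\<^sub>1)) \<and>
           \<comment> \<open>4b)\<close>
           (\<beta>\<^sub>1 \<noteq> 0 \<and> \<alpha>\<^sub>1 + 1 = 0 \<longrightarrow>
              (\<alpha>\<^sub>2 = - 1 \<or> (\<alpha>\<^sub>2 * \<beta>\<^sub>4 * C - C ^ 2 * \<Gamma>\<^sub>1 = - 2 \<and> \<alpha>\<^sub>2 \<noteq> - 1)) \<and>
              (\<alpha>\<^sub>2 = - 1 \<longrightarrow>
                 M = T \<and> \<beta>\<^sub>1 \<noteq> 0 \<and> \<beta>\<^sub>3 \<noteq> \<beta>\<^sub>1 / 2 \<and> \<beta>\<^sub>4 \<noteq> \<beta>\<^sub>1 / 2 \<and>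
                 \<beta>\<^sub>2 = \<beta>\<^sub>1 \<and> \<alpha>\<^sub>1 = - 1 \<and> \<alpha>\<^sub>2 = - 1 \<and>
                 \<alpha>\<^sub>1 = 1 + C * \<beta>\<^sub>1 \<and> \<alpha>\<^sub>2 = 1 + C * \<beta>\<^sub>2 \<and> \<alpha>\<^sub>3 = 1 + C * \<beta>\<^sub>3 \<and> \<alpha>\<^sub>4 = 1 + C * \<beta>\<^sub>4 \<and>
                 \<alpha>\<^sub>1 = 1 - 2 * \<beta>\<^sub>1 / \<beta>\<^sub>1 \<and> \<alpha>\<^sub>2 = 1 - 2 * \<beta>\<^sub>2 / \<beta>\<^sub>1 \<and>
                 \<alpha>\<^sub>3 = 1 - 2 * \<beta>\<^sub>3 / \<beta>\<^sub>1 \<and> \<alpha>\<^sub>4 = 1 - 2 * \<beta>\<^sub>4 / \<beta>\<^sub>1 \<and>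
                 A = - \<alpha>\<^sub>4 \<and>
                 B\<^sub>1 = - \<beta>\<^sub>4 \<and> B\<^sub>2 = - \<beta>\<^sub>3 \<and> B\<^sub>3 = - \<alpha>\<^sub>4 * \<beta>\<^sub>1 \<and> B\<^sub>4 = - \<alpha>\<^sub>3 * \<beta>\<^sub>1 \<and>
                 \<Gamma>\<^sub>2 = - \<beta>\<^sub>1 * \<beta>\<^sub>4 \<and> \<Gamma>\<^sub>3 = - \<beta>\<^sub>1 * \<beta>\<^sub>3 \<and> \<Gamma>\<^sub>4 = \<beta>\<^sub>1 * (\<beta>\<^sub>3 + \<beta>\<^sub>4) - \<Gamma>\<^sub>1) \<and>
              (\<alpha>\<^sub>2 * \<beta>\<^sub>4 * C - C ^ 2 * \<Gamma>\<^sub>1 = - 2 \<and> \<alpha>\<^sub>2 \<noteq> - 1 \<longrightarrow>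
                 M = T \<and> \<beta>\<^sub>1 \<noteq> 0 \<and> \<beta>\<^sub>2 \<noteq> \<beta>\<^sub>1 \<and>
                 \<beta>\<^sub>1 \<noteq> \<beta>\<^sub>1 / 2 \<and> \<beta>\<^sub>2 \<noteq> \<beta>\<^sub>1 / 2 \<and> \<beta>\<^sub>3 \<noteq> \<beta>\<^sub>1 / 2 \<and> \<beta>\<^sub>4 \<noteq> \<beta>\<^sub>1 / 2 \<and>
                 \<alpha>\<^sub>1 = - 1 \<and>
                 \<alpha>\<^sub>1 = 1 - 2 * \<beta>\<^sub>1 / \<beta>\<^sub>1 \<and> \<alpha>\<^sub>2 = 1 - 2 * \<beta>\<^sub>2 / \<beta>\<^sub>1 \<and>
                 \<alpha>\<^sub>3 = 1 - 2 * \<beta>\<^sub>3 / \<beta>\<^sub>1 \<and> \<alpha>\<^sub>4 = 1 - 2 * \<beta>\<^sub>4 / \<beta>\<^sub>1 \<and>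
                 \<beta>\<^sub>3 = 2 * \<beta>\<^sub>2 * \<beta>\<^sub>4 / \<beta>\<^sub>1 + \<beta>\<^sub>1 - \<beta>\<^sub>2 - \<beta>\<^sub>4 \<and> A = \<alpha>\<^sub>2 * \<alpha>\<^sub>4 \<and>
                 B\<^sub>1 = \<alpha>\<^sub>2 * \<beta>\<^sub>4 \<and> B\<^sub>2 = - \<beta>\<^sub>3 \<and> B\<^sub>3 = - \<alpha>\<^sub>4 * \<beta>\<^sub>2 \<and> B\<^sub>4 = 2 * \<beta>\<^sub>3 - \<beta>\<^sub>1 \<and>
                 \<Gamma>\<^sub>1 = (1 / 2) * (\<beta>\<^sub>1 ^ 2 - \<beta>\<^sub>4 * \<beta>\<^sub>1 + 2 * \<beta>\<^sub>2 * \<beta>\<^sub>4) \<and>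
                 \<Gamma>\<^sub>2 = - \<beta>\<^sub>2 * \<beta>\<^sub>4 \<and> \<Gamma>\<^sub>3 = - \<beta>\<^sub>1 * \<beta>\<^sub>3 \<and>
                 \<Gamma>\<^sub>4 = (1 / 2) * \<beta>\<^sub>1 * (- \<beta>\<^sub>1 + 2 * \<beta>\<^sub>3 + \<beta>\<^sub>4))) \<and>
           \<comment> \<open>4c)\<close>
           (\<beta>\<^sub>1 \<noteq> 0 \<and> \<alpha>\<^sub>1 + 1 \<noteq> 0 \<longrightarrow>
              M = T \<and> C \<noteq> 0 \<and> \<beta>\<^sub>1 \<noteq> 0 \<and> \<beta>\<^sub>1 \<noteq> - (1 / C) \<and> \<beta>\<^sub>2 \<noteq> - (1 / C) \<and> \<beta>\<^sub>3 \<noteq> - (1 / C) \<and>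
              \<alpha>\<^sub>1 = \<beta>\<^sub>1 * C + 1 \<and> \<alpha>\<^sub>2 = \<beta>\<^sub>2 * C + 1 \<and> \<alpha>\<^sub>3 = \<beta>\<^sub>3 * C + 1 \<and> \<alpha>\<^sub>4 = \<beta>\<^sub>4 * C + 1 \<and>
              \<beta>\<^sub>4 = (\<beta>\<^sub>1 - \<beta>\<^sub>2 + \<beta>\<^sub>3 + \<beta>\<^sub>1 * \<beta>\<^sub>3 * C) / (1 + \<beta>\<^sub>2 * C) \<and> A = \<alpha>\<^sub>2 * \<alpha>\<^sub>4 \<and>
              B\<^sub>1 = \<alpha>\<^sub>2 * \<beta>\<^sub>4 \<and> B\<^sub>2 = \<alpha>\<^sub>1 * \<beta>\<^sub>3 \<and> B\<^sub>3 = - \<alpha>\<^sub>4 * \<beta>\<^sub>2 \<and> B\<^sub>4 = - \<alpha>\<^sub>3 * \<beta>\<^sub>1 \<and>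
              \<Gamma>\<^sub>1 = (\<beta>\<^sub>3 * \<alpha>\<^sub>1 - \<beta>\<^sub>2) / C \<and> \<Gamma>\<^sub>2 = - \<beta>\<^sub>2 * \<beta>\<^sub>4 \<and> \<Gamma>\<^sub>3 = - \<beta>\<^sub>1 * \<beta>\<^sub>3 \<and>
              \<Gamma>\<^sub>4 = (\<beta>\<^sub>4 * C * \<beta>\<^sub>2 + \<beta>\<^sub>2 - \<beta>\<^sub>3) / C))))"
proof -
  interpret flip_square r x y \<alpha>\<^sub>1 \<alpha>\<^sub>2 \<alpha>\<^sub>3 \<alpha>\<^sub>4 \<beta>\<^sub>1 \<beta>\<^sub>2 \<beta>\<^sub>3 \<beta>\<^sub>4 A B\<^sub>1 B\<^sub>2 B\<^sub>3 B\<^sub>4 \<Gamma>\<^sub>1 \<Gamma>\<^sub>2 \<Gamma>\<^sub>3 \<Gamma>\<^sub>4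
    using assms by unfold_locales (simp_all add: non_degenerate_braided_set_def)
  \<comment> \<open>\<open>T\<close> is written with the coefficients of \<open>r\<close>
    themselves, so this one equality serves every case; the cases differ only in the relations among
    the entries.\<close>
  have MT: "M = T" unfolding M T by (rule coeff_matrix_eq)
  note rel = xyxy_relations and nz = alpha_nonzero
  have A: "A = \<alpha>\<^sub>2 * \<alpha>\<^sub>4" using rel(1,2) by simp
  show ?thesis
  proof ((rule conjI[OF _ conjI]; rule impI), goal_cases)
    case 1
    moreover have "\<alpha>\<^sub>4 = \<alpha>\<^sub>1 * \<alpha>\<^sub>3 / \<alpha>\<^sub>2" using rel(2) nz by (simp add: field_simps)
    ultimately show ?case using MT rel(1,3-) nz by simp
  next
    case 2
    then have "\<alpha>\<^sub>1 \<in> {1, - 1}" "\<alpha>\<^sub>3 \<in> {1, - 1}" "\<alpha>\<^sub>2 = \<alpha>\<^sub>1" "\<alpha>\<^sub>4 = \<alpha>\<^sub>3"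
      using alpha_signs by blast+
    with 2 show ?case using MT rel(1,3-) by simp
  next
    case nonzero: 3
    \<comment> \<open>As some \<beta> is nonzero, these equations determine \<open>C\<close>, so
      this witness is the only possible one.\<close>
    then obtain C where alpha_C: "\<alpha>\<^sub>1 = 1 + C * \<beta>\<^sub>1" "\<alpha>\<^sub>2 = 1 + C * \<beta>\<^sub>2"
        "\<alpha>\<^sub>3 = 1 + C * \<beta>\<^sub>3" "\<alpha>\<^sub>4 = 1 + C * \<beta>\<^sub>4"
      by (rule ex_proportionality_factor)
    have ne: "C * \<beta>\<^sub>1 \<noteq> - 1" "C * \<beta>\<^sub>2 \<noteq> - 1" "C * \<beta>\<^sub>3 \<noteq> - 1" "C * \<beta>\<^sub>4 \<noteq> - 1"
      using nz unfolding alpha_C by auto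
    show ?case
    \<comment> \<open>Goals 1 to 4 are the proportionality equations, discharged at the end of the
      block; goals 5 and 6 are the cases \<open>C = 0\<close> and
      \<open>C \<noteq> 0\<close>.\<close>
    proof (rule exI[of _ C], intro conjI, goal_cases)
      case 5
      have alpha: "\<alpha>\<^sub>1 = 1" "\<alpha>\<^sub>2 = 1" "\<alpha>\<^sub>3 = 1" "\<alpha>\<^sub>4 = 1" if "C = 0"
        using alpha_C that by simp_all
      show ?case
      proof (rule impI, (rule conjI[OF _ conjI]; (rule impI)?), goal_cases)
        case 1
        show ?case by (rule unipotent_cases[OF nonzero alpha[OF 1]])
      next
        case 2
        then show ?case using MT rel alpha[OF 2(1)] nonzero by auto
      next
        case 3
        then have sum: "\<beta>\<^sub>3 + \<beta>\<^sub>4 = 0" "\<beta>\<^sub>1 + \<beta>\<^sub>2 = 0" "\<beta>\<^sub>3 \<noteq> - \<beta>\<^sub>1" by simp_all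
        have neg: "\<beta>\<^sub>2 = - \<beta>\<^sub>1" "\<beta>\<^sub>4 = - \<beta>\<^sub>3"
          using sum(1,2) by (simp_all add: eq_neg_iff_add_eq_0 add.commute)
        have "\<beta>\<^sub>1 + \<beta>\<^sub>3 \<noteq> 0"
          using sum(3) by (auto simp: eq_neg_iff_add_eq_0 add.commute)
        then show ?case
          using MT rel unipotent_Gamma[OF alpha[OF 3(1)] sum] by (simp add: alpha[OF 3(1)] neg)
      qed
    next
      case 6
      show ?case
      proof (rule impI, (rule conjI[OF _ conjI[OF _ conjI]]; (rule impI)?), goal_cases)
        case 1
        show ?case by (rule beta1_factors[OF alpha_C 1])
      next
        case zero: 2
        note C = zero(1) and b1 = zero(2)
        have 1: "\<alpha>\<^sub>1 = 1" using alpha_C b1 by simp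
        have b3: "\<beta>\<^sub>3 = \<beta>\<^sub>2 + \<alpha>\<^sub>2 * \<beta>\<^sub>4"
          using beta_relation[OF alpha_C C] b1 1 by (simp add: algebra_simps)
        have b24: "(\<beta>\<^sub>2, \<beta>\<^sub>4) \<noteq> (0, 0)"
          using nonzero b1 b3 by auto
        show ?case
        proof ((rule conjI[OF _ conjI]; (rule impI)?), goal_cases)
          case 1
          show ?case
            using beta1_zero[OF alpha_C C b1] alpha_C C by (auto simp: field_simps)
        next
          case 2
          then show ?case
            using MT rel A C b1 1 b3 b24 ne alpha_C by simp
        next
          case 3
          then have b2: "\<beta>\<^sub>2 = 0" and G: "C * \<Gamma>\<^sub>1 \<noteq> \<beta>\<^sub>4" using C by (auto simp: field_simps)
          have b4: "\<beta>\<^sub>4 \<noteq> 0" using b24 b2 by simp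
          note minus = beta12_zero[OF alpha_C C b1 b2 b4 G]
          \<comment> \<open>From this equation 2 is nonzero, and the excluded value
            \<open>\<beta>\<^sub>4 / C\<close> of \<open>\<Gamma>\<^sub>1\<close> turns into
            \<open>- (\<beta>\<^sub>4 ^ 2 / 2)\<close>.\<close>
          have Cb4: "C * \<beta>\<^sub>4 = - 2"
            using minus alpha_C(4) by (simp add: eq_neg_iff_add_eq_0 add.commute)
          with C b4 have two: "(2 :: 'k) \<noteq> 0" by auto
          have "C * (- (\<beta>\<^sub>4 ^ 2 / 2)) = - (C * \<beta>\<^sub>4) * \<beta>\<^sub>4 / 2"
            by (simp add: power2_eq_square)
          also have "\<dots> = \<beta>\<^sub>4" unfolding Cb4 using two by simp
          finally have "C * (- (\<beta>\<^sub>4 ^ 2 / 2)) = \<beta>\<^sub>4" .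
          then have "\<Gamma>\<^sub>1 \<noteq> - (\<beta>\<^sub>4 ^ 2 / 2)" using G by metis
          then show ?case
            using MT rel A b1 b2 b4 1 minus alpha_C by simp
        qed
      next
        case minus: 3
        note C = minus(1)
        have 1: "\<alpha>\<^sub>1 = - 1" and b1: "\<beta>\<^sub>1 \<noteq> 0" using minus(2) by (simp_all add: eq_neg_iff_add_eq_0)
        have Cb1: "C * \<beta>\<^sub>1 = - 2" using 1 alpha_C(1) by (simp add: eq_neg_iff_add_eq_0 add.commute)
        \<comment> \<open>so this case does not occur in characteristic two\<close>
        then have two: "(2 :: 'k) \<noteq> 0" using C b1 by auto
        have C_eq: "C = - 2 / \<beta>\<^sub>1" using Cb1 b1 by (simp add: field_simps)
        have alpha: "\<alpha>\<^sub>1 = 1 - 2 * \<beta>\<^sub>1 / \<beta>\<^sub>1" "\<alpha>\<^sub>2 = 1 - 2 * \<beta>\<^sub>2 / \<beta>\<^sub>1"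
            "\<alpha>\<^sub>3 = 1 - 2 * \<beta>\<^sub>3 / \<beta>\<^sub>1" "\<alpha>\<^sub>4 = 1 - 2 * \<beta>\<^sub>4 / \<beta>\<^sub>1"
          by (simp_all add: alpha_C C_eq)
        \<comment> \<open>Because \<open>C * \<beta>\<^sub>1 = - 2\<close>, half of
          \<open>\<beta>\<^sub>1\<close> is exactly where \<open>1 + C * b\<close> vanishes, and no
          \<alpha> is zero.\<close>
        have "b \<noteq> \<beta>\<^sub>1 / 2" if "1 + C * b \<noteq> 0" for b
        proof
          assume "b = \<beta>\<^sub>1 / 2"
          then have "C * b = (C * \<beta>\<^sub>1) / 2" by simp
          also have "\<dots> = - 1" unfolding Cb1 using two by simp
          finally show False using that by simp
        qed
        then have half: "\<beta>\<^sub>1 \<noteq> \<beta>\<^sub>1 / 2" "\<beta>\<^sub>2 \<noteq> \<beta>\<^sub>1 / 2" "\<beta>\<^sub>3 \<noteq> \<beta>\<^sub>1 / 2" "\<beta>\<^sub>4 \<noteq> \<beta>\<^sub>1 / 2"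
          using nz unfolding alpha_C by blast+
        show ?case
        proof ((rule conjI[OF _ conjI]; (rule impI)?), goal_cases)
          case 1
          show ?case
            using alpha1_minus_one[OF alpha_C C] minus(2) by blast
        next
          case 2
          have "1 + C * \<beta>\<^sub>2 = 1 + C * \<beta>\<^sub>1" using 2 1 alpha_C(1,2) by metis
          then have b2: "\<beta>\<^sub>2 = \<beta>\<^sub>1" using C by simp
          have entries: "A = - \<alpha>\<^sub>4" "B\<^sub>1 = - \<beta>\<^sub>4" "B\<^sub>2 = - \<beta>\<^sub>3" "B\<^sub>3 = - \<alpha>\<^sub>4 * \<beta>\<^sub>1" "\<Gamma>\<^sub>2 = - \<beta>\<^sub>1 * \<beta>\<^sub>4"
            "\<Gamma>\<^sub>4 = \<beta>\<^sub>1 * (\<beta>\<^sub>3 + \<beta>\<^sub>4) - \<Gamma>\<^sub>1"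
            by (simp_all add: A rel(3-5,7,9) 1 2 b2 distrib_left)
          show ?case
            by (intro conjI) (fact entries MT b1 half b2 1 2 alpha_C alpha rel(6,8))+
        next
          case 3
          have b2: "\<beta>\<^sub>2 \<noteq> \<beta>\<^sub>1" using 3 alpha_C(1,2) 1 by auto
          have b3: "\<beta>\<^sub>3 = 2 * \<beta>\<^sub>2 * \<beta>\<^sub>4 / \<beta>\<^sub>1 + \<beta>\<^sub>1 - \<beta>\<^sub>2 - \<beta>\<^sub>4"
            using beta_relation[OF alpha_C C] b1 unfolding 1 alpha(2) by (simp add: field_simps)
          have B2: "B\<^sub>2 = - \<beta>\<^sub>3" using rel(4) 1 by simp
          have B4: "B\<^sub>4 = 2 * \<beta>\<^sub>3 - \<beta>\<^sub>1"
            unfolding rel(6) alpha(3) using b1 by (simp add: field_simps)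
          have a2: "\<alpha>\<^sub>2 * \<beta>\<^sub>1 = \<beta>\<^sub>1 - 2 * \<beta>\<^sub>2"
            unfolding alpha(2) using b1 by (simp add: field_simps)
          \<comment> \<open>The factor \<open>\<beta>\<^sub>1 ^ 2\<close> makes \<open>C\<close>
            occur only in the product \<open>C * \<beta>\<^sub>1\<close>, which is -2; afterwards 2
            can be cancelled.\<close>
          have "\<beta>\<^sub>1 ^ 2 * (\<alpha>\<^sub>2 * \<beta>\<^sub>4 * C - C ^ 2 * \<Gamma>\<^sub>1)
              = (\<alpha>\<^sub>2 * \<beta>\<^sub>1) * \<beta>\<^sub>4 * (C * \<beta>\<^sub>1) - (C * \<beta>\<^sub>1) * (C * \<beta>\<^sub>1) * \<Gamma>\<^sub>1"
            by (simp add: power2_eq_square algebra_simps)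
          also have "\<dots> = - 2 * ((\<beta>\<^sub>1 - 2 * \<beta>\<^sub>2) * \<beta>\<^sub>4 + 2 * \<Gamma>\<^sub>1)"
            unfolding a2 Cb1 by (simp add: algebra_simps)
          finally have "(- 2) * (\<beta>\<^sub>1 ^ 2) = - 2 * ((\<beta>\<^sub>1 - 2 * \<beta>\<^sub>2) * \<beta>\<^sub>4 + 2 * \<Gamma>\<^sub>1)"
            using 3 by (simp add: mult.commute)
          then have "\<beta>\<^sub>1 ^ 2 = (\<beta>\<^sub>1 - 2 * \<beta>\<^sub>2) * \<beta>\<^sub>4 + 2 * \<Gamma>\<^sub>1"
            using two by (metis mult_left_cancel neg_equal_0_iff_equal)
          then have "\<beta>\<^sub>1 ^ 2 - \<beta>\<^sub>4 * \<beta>\<^sub>1 + 2 * \<beta>\<^sub>2 * \<beta>\<^sub>4 = 2 * \<Gamma>\<^sub>1"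
            by (simp add: algebra_simps)
          then have G1: "\<Gamma>\<^sub>1 = (1 / 2) * (\<beta>\<^sub>1 ^ 2 - \<beta>\<^sub>4 * \<beta>\<^sub>1 + 2 * \<beta>\<^sub>2 * \<beta>\<^sub>4)"
            using two by simp
          have G4: "\<Gamma>\<^sub>4 = (1 / 2) * \<beta>\<^sub>1 * (- \<beta>\<^sub>1 + 2 * \<beta>\<^sub>3 + \<beta>\<^sub>4)"
            unfolding rel(9) G1 using two by (simp add: field_simps power2_eq_square)
          show ?case
            by (intro conjI) (fact MT b1 b2 half 1 alpha b3 A rel(3,5,7,8) B2 B4 G1 G4)+
        qed
      next
        case 4
        then have C: "C \<noteq> 0" and b1: "\<beta>\<^sub>1 \<noteq> 0" by simp_all
        have "\<beta>\<^sub>3 * \<alpha>\<^sub>1 - \<beta>\<^sub>2 - \<Gamma>\<^sub>1 * C = 0"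
          using beta1_factors[OF alpha_C C] 4 unfolding mult_eq_0_iff by blast
        then have G1: "\<Gamma>\<^sub>1 = (\<beta>\<^sub>3 * \<alpha>\<^sub>1 - \<beta>\<^sub>2) / C"
          using C by (simp add: field_simps)
        have b4: "\<beta>\<^sub>4 = (\<beta>\<^sub>1 - \<beta>\<^sub>2 + \<beta>\<^sub>3 + \<beta>\<^sub>1 * \<beta>\<^sub>3 * C) / (1 + \<beta>\<^sub>2 * C)"
          using beta_relation[OF alpha_C C] nz(2) unfolding alpha_C by (simp add: field_simps)
        have G4: "\<Gamma>\<^sub>4 = (\<beta>\<^sub>4 * C * \<beta>\<^sub>2 + \<beta>\<^sub>2 - \<beta>\<^sub>3) / C"
          unfolding rel(9) G1 alpha_C using C by (simp add: field_simps)
        have inv: "\<beta>\<^sub>1 \<noteq> - (1 / C)" "\<beta>\<^sub>2 \<noteq> - (1 / C)" "\<beta>\<^sub>3 \<noteq> - (1 / C)"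
          using ne C by auto
        have comm: "\<alpha>\<^sub>1 = \<beta>\<^sub>1 * C + 1" "\<alpha>\<^sub>2 = \<beta>\<^sub>2 * C + 1" "\<alpha>\<^sub>3 = \<beta>\<^sub>3 * C + 1" "\<alpha>\<^sub>4 = \<beta>\<^sub>4 * C + 1"
          by (simp_all add: alpha_C mult.commute)
        show ?case
          by (intro conjI) (fact MT C b1 inv comm b4 A rel G1 G4)+
      qed
    qed (simp_all add: alpha_C)
  qed
qed

end
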